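(* Let $H:\mathbb R\to\mathbb R$ be smooth with $\|H'\|_\infty<\infty$, let $\theta\in(0,1]$ and $L>0$. There exists $C>0$ depending only on $L$ (for the fixed $H$, $\theta$) such that the following holds. Let $T>0$, let $u_0:\mathbb R\to\mathbb R$ be bounded and Lipschitz with $\|u_0'\|_\infty\le L$, and let $W\in C([0,T];\mathbb R)$ have modulus of continuity $\omega:[0,\infty)\to[0,\infty)$. For $h>0$ define $\rho_h$ implicitly by $$\lambda:=\frac{(\rho_h)^{1/2}\,\omega\big((\rho_h)^{1/2}\big)}{h}<\frac{\theta}{\|H'\|_\infty},$$ where $\lambda$ is a fixed constant, and set $\mathcal P_h:=\{n\rho_h\wedge T\}_{n\in\mathbb N_0}$, $M_h:=\lfloor(\rho_h)^{-1/2}\rfloor$, and, for $k\in\mathbb N_0$ and $t\in[kM_h\rho_h,(k+1)M_h\rho_h)$, $$W_h(t):=W(kM_h\rho_h)+\frac{W((k+1)M_h\rho_h)-W(kM_h\rho_h)}{M_h\rho_h}\,(t-kM_h\rho_h).$$ Let $u$ be the pathwise viscosity solution of $du=H(u_x)\circ dW$ in $\mathbb R\times(0,T]$, $u(\cdot,0)=u_0$. Writing $\mathcal P_h=\{0=t_0<\dots<t_N=T\}$, let $u_h(\cdot,0):=u_0$ and $u_h(\cdot,t):=S_h(t,t_n;W_h)u_h(\cdot,t_n)$ for $t\in(t_n,t_{n+1}]$, $n=0,\dots,N-1$, where $$S_h(t,s;\zeta)w(x):=w(x)+H\Big(\tfrac{w(x+h)-w(x-h)}{2h}\Big)(\zeta(t)-\zeta(s))+\tfrac\theta2\big(w(x+h)+w(x-h)-2w(x)\big).$$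 Then $$\sup_{(x,t)\in\mathbb R\times[0,T]}|u_h(x,t)-u(x,t)|\le C(1+T)\,\omega\big((\rho_h)^{1/2}\big).$$
   Context: $a\wedge b=\min(a,b)$; $\mathbb N_0=\{0,1,2,\dots\}$. Where values of $W$ at times after $T$ occur in the definition of $W_h$, $W$ is understood to be extended by $W(t)=W(T)$. Pathwise viscosity solutions. For an open interval $I\subset[0,T]$, $C(I,C^{1,1}(\mathbb R))$ denotes functions $\Phi$ with $\Phi,\Phi_x$ continuous on $\mathbb R\times I$ and $\Phi_x(\cdot,t)$ Lipschitz, locally uniformly in $t\in I$. Such $\Phi$ is a solution of $d\Phi=H(\Phi_x)\circ dW$ in $\mathbb R\times I$ if it is obtained by continuous extension from smooth paths: there are $C^1$ paths $W_n\to W$ uniformly on $I$ and $\Phi_n\in C(I,C^{1,1}(\mathbb R))$, with Lipschitz constants of $\Phi_{n,x}(\cdot,t)$ bounded uniformly in $n$ locally uniformly in $t$, satisfying $\partial_t\Phi_n=H(\Phi_{n,x})\dot W_n$ pointwise, with $\Phi_n\to\Phi$ and $\Phi_{n,x}\to\Phi_x$ locally uniformly. An upper (resp. lower) semicontinuous $u$ on $\mathbb R\times[0,T]$ is a pathwise viscosity sub- (resp. super-) solution of $du=H(u_x)\circ dW$, $u(\cdot,0)=u_0$, if $u(\cdot,0)\le u_0$ (resp. $\ge$) and, whenever $\psi\in C^1([0,T])$, $\Phi\in C(I,C^{1,1}(\mathbb R))$ is such a solution, and $u-\Phi-\psi$ attains a local maximum (resp. minimum) at $(x_0,t_0)\in\mathbb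 R\times I$, then $\psi'(t_0)\le0$ (resp. $\ge0$). A solution is both. There is a unique bounded uniformly continuous solution.
   Formalization: Assumes M_h ≥ 1 (else W_h is undefined) and λ‖H'‖ ≤ θ ρ_h^{1/2} M_h, the CFL condition for the actual steps, automatic for small ρ_h, without which the claim fails; λ > 0 is fixed in advance and C may depend on it. *)

theory Defs
  imports "HOL-Analysis.Analysis"
begin

section \<open>Functions of one variable\<close>

definition smooth :: "(real \<Rightarrow> real) \<Rightarrow> bool" where
  "smooth f \<longleftrightarrow> (\<forall>k x. (deriv ^^ k) f field_differentiable at x)"

text \<open>Only meaningful for bounded \<open>f\<close>; boundedness is always assumed separately.\<close>

definition sup_norm :: "(real \<Rightarrow> real) \<Rightarrow> real" where
  "sup_norm f = (SUP x. \<bar>f x\<bar>)"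

text \<open>A Lipschitz function is differentiable almost everywhere, so the second conjunct is the
  essential bound \<open>L\<close> on the a.e. defined derivative of \<open>f\<close>.\<close>

definition lipschitz_with_deriv_bound :: "real \<Rightarrow> (real \<Rightarrow> real) \<Rightarrow> bool" where
  "lipschitz_with_deriv_bound L f \<longleftrightarrow>
     (\<exists>K. K-lipschitz_on UNIV f) \<and>
     (AE x in lborel. f field_differentiable at x \<and> \<bar>deriv f x\<bar> \<le> L)"

text \<open>\<open>\<omega>\<close> is any modulus dominating the oscillation of \<open>W\<close>; the minimal one, the supremum of
  \<open>\<bar>W s - W t\<bar>\<close> over \<open>\<bar>s - t\<bar> \<le> r\<close>, is a particular case.\<close>

definition modulus_of_continuity :: "(real \<Rightarrow> real) \<Rightarrow> (real \<Rightarrow> real) \<Rightarrow> real \<Rightarrow> bool" where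
  "modulus_of_continuity \<omega> W T \<longleftrightarrow>
     \<omega> 0 = 0 \<and> (\<forall>r\<ge>0. 0 \<le> \<omega> r) \<and> mono_on {0..} \<omega> \<and> (\<omega> \<longlongrightarrow> 0) (at_right 0) \<and>
     (\<forall>s\<in>{0..T}. \<forall>t\<in>{0..T}. \<bar>W s - W t\<bar> \<le> \<omega> \<bar>s - t\<bar>)"


section \<open>Pathwise viscosity solutions\<close>

text \<open>Space-time functions are curried, space variable first.\<close>

definition dx :: "(real \<Rightarrow> real \<Rightarrow> real) \<Rightarrow> real \<Rightarrow> real \<Rightarrow> real" where
  "dx \<Phi> x t = deriv (\<lambda>y. \<Phi> y t) x"

definition C_C11 :: "real set \<Rightarrow> (real \<Rightarrow> real \<Rightarrow> real) \<Rightarrow> bool" where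
  "C_C11 I \<Phi> \<longleftrightarrow>
     (\<forall>x. \<forall>t\<in>I. (\<lambda>y. \<Phi> y t) field_differentiable at x) \<and>
     continuous_on (UNIV \<times> I) (\<lambda>(x, t). \<Phi> x t) \<and>
     continuous_on (UNIV \<times> I) (\<lambda>(x, t). dx \<Phi> x t) \<and>
     (\<forall>K. compact K \<and> K \<subseteq> I \<longrightarrow> (\<exists>B. \<forall>t\<in>K. B-lipschitz_on UNIV (\<lambda>x. dx \<Phi> x t)))"

text \<open>Solutions of \<open>d\<Phi> = H(\<Phi>\<^sub>x) \<circ> dW\<close> in \<open>\<real> \<times> I\<close> (\<open>I\<close> an open interval), obtained by continuous
  extension from \<open>C\<^sup>1\<close> paths.\<close>

definition C11_solution ::
    "(real \<Rightarrow> real) \<Rightarrow> (real \<Rightarrow> real) \<Rightarrow> real set \<Rightarrow> (real \<Rightarrow> real \<Rightarrow> real) \<Rightarrow> bool" where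
  "C11_solution H W I \<Phi> \<longleftrightarrow>
     C_C11 I \<Phi> \<and>
     (\<exists>Wn :: nat \<Rightarrow> real \<Rightarrow> real. \<exists>\<Phi>n :: nat \<Rightarrow> real \<Rightarrow> real \<Rightarrow> real.
        (\<forall>n. Wn n C1_differentiable_on I) \<and>
        uniform_limit I Wn W sequentially \<and>
        (\<forall>n. C_C11 I (\<Phi>n n)) \<and>
        (\<forall>K. compact K \<and> K \<subseteq> I \<longrightarrow>
             (\<exists>B. \<forall>n. \<forall>t\<in>K. B-lipschitz_on UNIV (\<lambda>x. dx (\<Phi>n n) x t))) \<and>
        (\<forall>n x. \<forall>t\<in>I. ((\<lambda>s. \<Phi>n n x s) has_real_derivative
                         H (dx (\<Phi>n n) x t) * deriv (Wn n) t) (at t)) \<and>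
        (\<forall>K. compact K \<and> K \<subseteq> UNIV \<times> I \<longrightarrow>
             uniform_limit K (\<lambda>n (x, t). \<Phi>n n x t) (\<lambda>(x, t). \<Phi> x t) sequentially \<and>
             uniform_limit K (\<lambda>n (x, t). dx (\<Phi>n n) x t) (\<lambda>(x, t). dx \<Phi> x t) sequentially))"

definition upper_semicontinuous_on :: "'a::topological_space set \<Rightarrow> ('a \<Rightarrow> real) \<Rightarrow> bool" where
  "upper_semicontinuous_on S f \<longleftrightarrow>
     (\<forall>z\<in>S. \<forall>a. f z < a \<longrightarrow> (\<forall>\<^sub>F y in at z within S. f y < a))"

definition lower_semicontinuous_on :: "'a::topological_space set \<Rightarrow> ('a \<Rightarrow> real) \<Rightarrow> bool" where
  "lower_semicontinuous_on S f \<longleftrightarrow>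
     (\<forall>z\<in>S. \<forall>a. a < f z \<longrightarrow> (\<forall>\<^sub>F y in at z within S. a < f y))"

definition local_max_at :: "'a::topological_space set \<Rightarrow> ('a \<Rightarrow> real) \<Rightarrow> 'a \<Rightarrow> bool" where
  "local_max_at S g z \<longleftrightarrow> z \<in> S \<and> (\<forall>\<^sub>F y in at z within S. g y \<le> g z)"

definition local_min_at :: "'a::topological_space set \<Rightarrow> ('a \<Rightarrow> real) \<Rightarrow> 'a \<Rightarrow> bool" where
  "local_min_at S g z \<longleftrightarrow> z \<in> S \<and> (\<forall>\<^sub>F y in at z within S. g z \<le> g y)"

text \<open>\<open>\<psi> \<in> C\<^sup>1([0,T])\<close> with derivative \<open>\<psi>'\<close>, one-sided at the end points.\<close>

definition C1_closed :: "real \<Rightarrow> (real \<Rightarrow> real) \<Rightarrow> (real \<Rightarrow> real) \<Rightarrow> bool" where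
  "C1_closed T \<psi> \<psi>' \<longleftrightarrow>
     (\<forall>t\<in>{0..T}. (\<psi> has_real_derivative \<psi>' t) (at t within {0..T})) \<and>
     continuous_on {0..T} \<psi>'"

definition pathwise_subsolution ::
    "(real \<Rightarrow> real) \<Rightarrow> (real \<Rightarrow> real) \<Rightarrow> real \<Rightarrow> (real \<Rightarrow> real) \<Rightarrow> (real \<Rightarrow> real \<Rightarrow> real) \<Rightarrow> bool" where
  "pathwise_subsolution H W T u0 u \<longleftrightarrow>
     upper_semicontinuous_on (UNIV \<times> {0..T}) (\<lambda>(x, t). u x t) \<and>
     (\<forall>x. u x 0 \<le> u0 x) \<and>
     (\<forall>a b \<Phi> \<psi> \<psi>' x0 t0.
        0 \<le> a \<and> a < b \<and> b \<le> T \<and> C1_closed T \<psi> \<psi>' \<and> C11_solution H W {a<..<b} \<Phi> \<and>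
        local_max_at (UNIV \<times> {a<..<b}) (\<lambda>(x, t). u x t - \<Phi> x t - \<psi> t) (x0, t0)
        \<longrightarrow> \<psi>' t0 \<le> 0)"

definition pathwise_supersolution ::
    "(real \<Rightarrow> real) \<Rightarrow> (real \<Rightarrow> real) \<Rightarrow> real \<Rightarrow> (real \<Rightarrow> real) \<Rightarrow> (real \<Rightarrow> real \<Rightarrow> real) \<Rightarrow> bool" where
  "pathwise_supersolution H W T u0 u \<longleftrightarrow>
     lower_semicontinuous_on (UNIV \<times> {0..T}) (\<lambda>(x, t). u x t) \<and>
     (\<forall>x. u0 x \<le> u x 0) \<and>
     (\<forall>a b \<Phi> \<psi> \<psi>' x0 t0.
        0 \<le> a \<and> a < b \<and> b \<le> T \<and> C1_closed T \<psi> \<psi>' \<and> C11_solution H W {a<..<b} \<Phi> \<and>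
        local_min_at (UNIV \<times> {a<..<b}) (\<lambda>(x, t). u x t - \<Phi> x t - \<psi> t) (x0, t0)
        \<longrightarrow> 0 \<le> \<psi>' t0)"

text \<open>The solution is the unique one in the class of bounded uniformly continuous functions, so
  membership in this class is part of the definition.\<close>

definition pathwise_solution ::
    "(real \<Rightarrow> real) \<Rightarrow> (real \<Rightarrow> real) \<Rightarrow> real \<Rightarrow> (real \<Rightarrow> real) \<Rightarrow> (real \<Rightarrow> real \<Rightarrow> real) \<Rightarrow> bool" where
  "pathwise_solution H W T u0 u \<longleftrightarrow>
     pathwise_subsolution H W T u0 u \<and> pathwise_supersolution H W T u0 u \<and>
     bounded ((\<lambda>(x, t). u x t) ` (UNIV \<times> {0..T})) \<and>
     uniformly_continuous_on (UNIV \<times> {0..T}) (\<lambda>(x, t). u x t)"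


section \<open>The scheme\<close>

definition M_steps :: "real \<Rightarrow> nat" where
  "M_steps \<rho> = nat \<lfloor>\<rho> powr (- 1 / 2)\<rfloor>"

text \<open>The path \<open>W\<close>, frozen after time \<open>T\<close>, interpolated at the multiples of \<open>M\<^sub>h \<rho>\<^sub>h\<close>; here
  \<open>k = \<lfloor>t / (M\<^sub>h \<rho>\<^sub>h)\<rfloor>\<close> is the index with \<open>k M\<^sub>h \<rho>\<^sub>h \<le> t < (k + 1) M\<^sub>h \<rho>\<^sub>h\<close>.
  The construction requires \<open>M\<^sub>h \<ge> 1\<close>.\<close>

definition W_interp :: "(real \<Rightarrow> real) \<Rightarrow> real \<Rightarrow> real \<Rightarrow> real \<Rightarrow> real" where
  "W_interp W T \<rho> t =
     (let \<tau> = real (M_steps \<rho>) * \<rho>;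
          k = real_of_int \<lfloor>t / \<tau>\<rfloor>;
          Wbar = (\<lambda>s. W (min s T))
      in Wbar (k * \<tau>) + (Wbar ((k + 1) * \<tau>) - Wbar (k * \<tau>)) / \<tau> * (t - k * \<tau>))"

definition S_op ::
    "(real \<Rightarrow> real) \<Rightarrow> real \<Rightarrow> real \<Rightarrow> real \<Rightarrow> real \<Rightarrow> (real \<Rightarrow> real) \<Rightarrow> (real \<Rightarrow> real) \<Rightarrow> real \<Rightarrow> real" where
  "S_op H \<theta> h t s \<zeta> w x =
     w x + H ((w (x + h) - w (x - h)) / (2 * h)) * (\<zeta> t - \<zeta> s)
         + \<theta> / 2 * (w (x + h) + w (x - h) - 2 * w x)"

definition grid :: "real \<Rightarrow> real \<Rightarrow> nat \<Rightarrow> real" where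
  "grid \<rho> T n = min (real n * \<rho>) T"

primrec u_grid ::
    "(real \<Rightarrow> real) \<Rightarrow> real \<Rightarrow> (real \<Rightarrow> real) \<Rightarrow> real \<Rightarrow> (real \<Rightarrow> real) \<Rightarrow> real \<Rightarrow> real \<Rightarrow> nat \<Rightarrow> real \<Rightarrow> real"
  where
  "u_grid H \<theta> W T u0 h \<rho> 0 = u0"
| "u_grid H \<theta> W T u0 h \<rho> (Suc n) =
     S_op H \<theta> h (grid \<rho> T (Suc n)) (grid \<rho> T n) (W_interp W T \<rho>) (u_grid H \<theta> W T u0 h \<rho> n)"

text \<open>For \<open>0 < t \<le> T\<close> the index \<open>n\<close> with \<open>t\<^sub>n < t \<le> t\<^sub>n\<^sub>+\<^sub>1\<close> is \<open>\<lceil>t / \<rho>\<rceil> - 1\<close>.\<close>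

definition u_approx ::
    "(real \<Rightarrow> real) \<Rightarrow> real \<Rightarrow> (real \<Rightarrow> real) \<Rightarrow> real \<Rightarrow> (real \<Rightarrow> real) \<Rightarrow> real \<Rightarrow> real \<Rightarrow> real \<Rightarrow> real \<Rightarrow> real"
  where
  "u_approx H \<theta> W T u0 h \<rho> x t =
     (if t \<le> 0 then u0 x
      else let n = nat (\<lceil>t / \<rho>\<rceil> - 1)
           in S_op H \<theta> h t (grid \<rho> T n) (W_interp W T \<rho>) (u_grid H \<theta> W T u0 h \<rho> n) x)"

lemma W_interp_block:
  assumes "0 < \<rho>" "1 \<le> M_steps \<rho>"
    and "real k * real (M_steps \<rho>) * \<rho> \<le> t" "t < (real k + 1) * real (M_steps \<rho>) * \<rho>"
  shows "W_interp W T \<rho> t =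
     W (min (real k * real (M_steps \<rho>) * \<rho>) T) +
     (W (min ((real k + 1) * real (M_steps \<rho>) * \<rho>) T) - W (min (real k * real (M_steps \<rho>) * \<rho>) T))
       / (real (M_steps \<rho>) * \<rho>) * (t - real k * real (M_steps \<rho>) * \<rho>)"
proof -
  have p: "0 < real (M_steps \<rho>) * \<rho>" using assms(1,2) by simp
  have "\<lfloor>t / (real (M_steps \<rho>) * \<rho>)\<rfloor> = int k"
    using p assms(3,4) by (intro floor_unique) (auto simp: field_simps)
  then show ?thesis by (simp add: W_interp_def Let_def mult.assoc)
qed

lemma u_approx_0: "u_approx H \<theta> W T u0 h \<rho> x 0 = u0 x"
  by (simp add: u_approx_def)

lemma u_approx_index:
  assumes "0 < \<rho>" "grid \<rho> T n < t" "t \<le> grid \<rho> T (Suc n)"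
  shows "real n * \<rho> < t" "nat (\<lceil>t / \<rho>\<rceil> - 1) = n"
proof -
  show n: "real n * \<rho> < t"
    using assms by (auto simp: grid_def min_def split: if_splits)
  have "t \<le> (real n + 1) * \<rho>" using assms(3) by (simp add: grid_def algebra_simps)
  then have "\<lceil>t / \<rho>\<rceil> = int n + 1"
    using n assms(1) by (intro ceiling_unique) (auto simp: field_simps)
  then show "nat (\<lceil>t / \<rho>\<rceil> - 1) = n" by simp
qed

lemma u_approx_grid:
  assumes "0 < \<rho>" "0 < T" "n = 0 \<or> grid \<rho> T (n - 1) < T"
  shows "u_approx H \<theta> W T u0 h \<rho> x (grid \<rho> T n) = u_grid H \<theta> W T u0 h \<rho> n x"
proof (cases n)
  case 0
  then show ?thesis using assms by (simp add: u_approx_def grid_def)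
next
  case (Suc m)
  then have lt: "grid \<rho> T m < grid \<rho> T n"
    using assms by (auto simp: grid_def min_def algebra_simps split: if_splits)
  have i: "real m * \<rho> < grid \<rho> T n" "nat (\<lceil>grid \<rho> T n / \<rho>\<rceil> - 1) = m"
    using u_approx_index[of \<rho> T m "grid \<rho> T n"] lt Suc assms(1) by auto
  have "\<not> grid \<rho> T n \<le> 0"
    using i(1) mult_nonneg_nonneg[of "real m" \<rho>] assms(1) by linarith
  with i Suc show ?thesis by (simp add: u_approx_def Let_def)
qed

lemma u_approx_step:
  assumes "0 < \<rho>" "0 < T" "grid \<rho> T n < t" "t \<le> grid \<rho> T (Suc n)"
  shows "u_approx H \<theta> W T u0 h \<rho> x t =
     S_op H \<theta> h t (grid \<rho> T n) (W_interp W T \<rho>) (\<lambda>y. u_approx H \<theta> W T u0 h \<rho> y (grid \<rho> T n)) x"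
proof -
  have "real n * \<rho> < t" "nat (\<lceil>t / \<rho>\<rceil> - 1) = n"
    using u_approx_index assms by blast+
  moreover have "\<not> t \<le> 0"
    using calculation(1) mult_nonneg_nonneg[of "real n" \<rho>] assms(1) by linarith
  moreover have "n = 0 \<or> grid \<rho> T (n - 1) < T"
  proof -
    have "real n * \<rho> < T" using assms by (auto simp: grid_def min_def split: if_splits)
    moreover have "real (n - 1) * \<rho> \<le> real n * \<rho>" using assms(1) by simp
    ultimately show ?thesis by (auto simp: grid_def)
  qed
  ultimately show ?thesis
    using assms(1,2) by (simp add: u_approx_def[of _ _ _ _ _ _ _ _ t] Let_def u_approx_grid)
qed

text \<open>Since the path \<open>W\<^sub>h\<close> has slope at most \<open>\<omega>(M\<^sub>h \<rho>\<^sub>h) / (M\<^sub>h \<rho>\<^sub>h)\<close>, its increment over one step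
  is at most \<open>\<omega>(\<rho>\<^sub>h\<^bsup>1/2\<^esup>) / M\<^sub>h = \<lambda> h / (\<rho>\<^sub>h\<^bsup>1/2\<^esup> M\<^sub>h)\<close>. The integer part makes \<open>\<rho>\<^sub>h\<^bsup>1/2\<^esup> M\<^sub>h\<close> smaller
  than 1 in general, and for large \<open>\<rho>\<^sub>h\<close> the condition \<open>\<lambda> \<parallel>H'\<parallel> < \<theta>\<close> alone does not make the scheme
  monotone. The condition on the actual step is \<open>\<lambda> \<parallel>H'\<parallel> \<le> \<theta> \<rho>\<^sub>h\<^bsup>1/2\<^esup> M\<^sub>h\<close>. By the next lemma it
  follows from \<open>\<lambda> \<parallel>H'\<parallel> < \<theta>\<close> as soon as \<open>\<rho>\<^sub>h\<close> is below a threshold depending only on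
  \<open>\<lambda>\<close>, \<open>\<theta>\<close> and \<open>\<parallel>H'\<parallel>\<close>.\<close>

lemma step_condition_eventually:
  assumes "0 \<le> q" "q < \<theta>"
  shows "\<forall>\<^sub>F \<rho> in at_right 0. 1 \<le> M_steps \<rho> \<and> q \<le> \<theta> * (sqrt \<rho> * real (M_steps \<rho>))"
proof -
  define r where "r = min 1 (1 - q / \<theta>)"
  have th: "0 < \<theta>" using assms by simp
  have r: "0 < r" "r \<le> 1" "q \<le> \<theta> * (1 - r)"
    using assms th by (auto simp: r_def field_simps min_def)
  have "1 \<le> M_steps \<rho> \<and> q \<le> \<theta> * (sqrt \<rho> * real (M_steps \<rho>))" if "0 < \<rho>" "\<rho> < r\<^sup>2" for \<rho>
  proof -
    have s: "0 < sqrt \<rho>" "sqrt \<rho> < r"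
      using that r real_less_lsqrt[of r \<rho>] by (auto simp: real_sqrt_less_iff)
    have e: "\<rho> powr (- 1 / 2) = 1 / sqrt \<rho>"
      using that powr_minus_divide[of \<rho> "1/2"] by (simp add: powr_half_sqrt)
    have "sqrt \<rho> \<le> 1" using s(2) r(2) by linarith
    then have g: "1 / sqrt \<rho> \<ge> 1" using s(1) by (simp only: le_divide_eq_1_pos)
    have "0 \<le> \<lfloor>1 / sqrt \<rho>\<rfloor>" using g by linarith
    then have M: "real (M_steps \<rho>) = real_of_int \<lfloor>1 / sqrt \<rho>\<rfloor>"
      by (simp only: M_steps_def e of_nat_nat)
    have "1 / sqrt \<rho> - 1 \<le> real (M_steps \<rho>)" unfolding M by linarith
    then have "sqrt \<rho> * (1 / sqrt \<rho> - 1) \<le> sqrt \<rho> * real (M_steps \<rho>)"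
      using s by (intro mult_left_mono) auto
    then have "1 - r \<le> sqrt \<rho> * real (M_steps \<rho>)" using s by (simp add: right_diff_distrib)
    then have "\<theta> * (1 - r) \<le> \<theta> * (sqrt \<rho> * real (M_steps \<rho>))"
      using th by (intro mult_left_mono) auto
    moreover have "1 \<le> M_steps \<rho>"
    proof -
      have "1 \<le> \<lfloor>1 / sqrt \<rho>\<rfloor>" using g by linarith
      then have "1 \<le> real (M_steps \<rho>)" unfolding M by simp
      then show ?thesis by simp
    qed
    ultimately show ?thesis using r(3) by linarith
  qed
  then show ?thesis
    using r(1) by (auto simp: eventually_at_right_field intro!: exI[of _ "r\<^sup>2"])
qed

end

theory Submission
  imports Defs
begin

text \<open>
  For \<open>\<delta>\<close> of the order of \<open>\<omega>(\<rho>\<^sup>1\<^sup>/\<^sup>2)\<close> put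
  \<open>g(z, \<xi>) = max {p z - \<delta> p\<^sup>2/2 + \<xi> H(p) | \<bar>p\<bar> \<le> L}\<close>. As long as \<open>\<bar>\<xi>\<bar>\<close> is small compared to \<open>\<delta>\<close>,
  the maximum is over a strongly concave function, so \<open>g\<close> is \<open>C\<^sup>1\<^sup>,\<^sup>1\<close> with \<open>g\<^sub>\<xi> = H(g\<^sub>z)\<close>; hence
  \<open>(x, t) \<mapsto> g(x - y, W(t) - c)\<close> is an admissible test function, and the supremum over \<open>x\<close> of its
  difference to a subsolution does not increase in time. Doubling variables between \<open>u\<close> and the
  scheme, one shows by induction over the time steps that
  \<open>u(x, t\<^sub>n) - g(x - y, W(t\<^sub>n) - W\<^sub>h(t\<^sub>n)) \<le> u\<^sub>h(y, t\<^sub>n) + m\<^sub>n\<close>: freeze \<open>W\<^sub>h\<close> and move \<open>W\<close> with the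
  comparison principle, then apply the monotone scheme in \<open>y\<close>. Since \<open>g\<close> is convex in \<open>\<xi>\<close> and
  \<open>g\<^sub>z\<^sub>z\<close> is at most of order \<open>1/\<omega>\<close>, a step costs \<open>O(h\<^sup>2/\<omega>) = O(\<rho> \<omega>)\<close>. The bound from below
  follows by replacing \<open>u\<close> with \<open>-u\<close> and \<open>H\<close> with \<open>p \<mapsto> -H(-p)\<close>.
\<close>

section \<open>The regularized kernel\<close>

text \<open>Only points between \<open>p\<close> and \<open>q\<close> compete with \<open>p\<close>,
  so a maximizer at the end of a constraint interval is covered too, where the derivative need not
  vanish.\<close>

lemma DERIV_at_segment_max:
  fixes F :: "real \<Rightarrow> real"
  assumes F: "(F has_real_derivative D) (at p)"
    and max: "\<And>s. 0 \<le> s \<Longrightarrow> s \<le> 1 \<Longrightarrow> F (p + s * (q - p)) \<le> F p"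
  shows "D * (q - p) \<le> 0"
proof (rule ccontr)
  assume "\<not> D * (q - p) \<le> 0"
  have "((\<lambda>s. F (p + s * (q - p))) has_real_derivative D * (q - p)) (at 0)"
    by (rule DERIV_chain2[where g = "\<lambda>s. p + s * (q - p)"])
      (use F in \<open>auto intro!: derivative_eq_intros\<close>)
  then obtain d where d: "0 < d" "\<And>s. 0 < s \<Longrightarrow> s < d \<Longrightarrow> F p < F (p + s * (q - p))"
    using DERIV_pos_inc_right[of "\<lambda>s. F (p + s * (q - p))" "D * (q - p)" 0] \<open>\<not> _\<close> by auto
  define s where "s = min 1 (d / 2)"
  have "0 < s" "s < d" "s \<le> 1" using d(1) by (auto simp: s_def min_def)
  then show False using d(2)[of s] max[of s] by simp
qed

lemma uniform_limit_rateI: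
  fixes f :: "nat \<Rightarrow> 'a \<Rightarrow> real"
  assumes "\<And>n z. z \<in> X \<Longrightarrow> \<bar>f n z - g z\<bar> \<le> c n" and "c \<longlonglongrightarrow> 0"
  shows "uniform_limit X f g sequentially"
proof (rule uniform_limitI)
  fix e :: real assume "0 < e"
  then have "\<forall>\<^sub>F n in sequentially. c n < e"
    using assms(2) order_tendstoD(2) by blast
  then show "\<forall>\<^sub>F n in sequentially. \<forall>z\<in>X. dist (f n z) (g z) < e"
  proof eventually_elim
    case (elim n)
    show ?case unfolding dist_real_def using le_less_trans[OF assms(1) elim] by blast
  qed
qed

text \<open>\<open>K\<close> acts as a bound for the second derivative of \<open>H\<close> on
  \<open>[-L, L]\<close>, so \<open>nondegenerate\<close> makes the function maximized below
  strongly concave there, with constant \<mu>, as long as \<open>\<bar>\<xi>\<bar> \<le> r\<close>.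
  With \<open>H'\<close> as a parameter, both \<open>H\<close> and the reflected
  \<open>p \<mapsto> - H (- p)\<close> can be inserted with an explicit derivative.\<close>

locale regularized_kernel =
  fixes H H' :: "real \<Rightarrow> real" and L \<delta> r \<mu> B K :: real
  assumes H_deriv: "\<And>p. (H has_real_derivative H' p) (at p)"
    and H'_bound: "\<And>p. \<bar>H' p\<bar> \<le> B"
    and H'_lipschitz: "\<And>p q. \<bar>p\<bar> \<le> L \<Longrightarrow> \<bar>q\<bar> \<le> L \<Longrightarrow> \<bar>H' p - H' q\<bar> \<le> K * \<bar>p - q\<bar>"
    and L_pos: "0 < L" and \<mu>_pos: "0 < \<mu>" and K_nonneg: "0 \<le> K"
    and nondegenerate: "r * K + \<mu> \<le> \<delta>"
begin

definition objective :: "real \<Rightarrow> real \<Rightarrow> real \<Rightarrow> real" where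
  "objective z \<xi> p = p * z - \<delta> * p\<^sup>2 / 2 + \<xi> * H p"

text \<open>Strong concavity gives a unique maximizer only for
  \<open>\<bar>\<xi>\<bar> \<le> r\<close>; the choice operator selects one for every \<xi>, so that
  \<open>kernel\<close> is a true maximum everywhere.\<close>

definition slope :: "real \<Rightarrow> real \<Rightarrow> real" where
  "slope z \<xi> = (SOME p. \<bar>p\<bar> \<le> L \<and> (\<forall>q. \<bar>q\<bar> \<le> L \<longrightarrow> objective z \<xi> q \<le> objective z \<xi> p))"

text \<open>A maximum of functions affine in \<open>(z, \<xi>)\<close>, hence jointly convex: the
  Hopf formula for the equation with Hamiltonian \<open>H\<close> and time \<xi>. For \<xi> = 0 and
  \<delta> > 0 it is the Huber function, equal to \<open>z\<^sup>2 / (2 * \<delta>)\<close> for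
  \<open>\<bar>z\<bar> \<le> \<delta> * L\<close> and affine with slopes \<open>L\<close> and
  \<open>- L\<close> beyond.\<close>

definition kernel :: "real \<Rightarrow> real \<Rightarrow> real" where
  "kernel z \<xi> = objective z \<xi> (slope z \<xi>)"

lemma B_nonneg: "0 \<le> B"
  using H'_bound[of 0] by linarith

lemma H_lipschitz: "\<bar>H p - H q\<bar> \<le> B * \<bar>p - q\<bar>"
  using field_differentiable_bound[of UNIV H H' B p q] H_deriv H'_bound by simp

lemma objective_deriv: "(objective z \<xi> has_real_derivative z - \<delta> * p + \<xi> * H' p) (at p)"
  unfolding objective_def by (auto intro!: derivative_eq_intros H_deriv)

lemma slope_props: "\<bar>slope z \<xi>\<bar> \<le> L \<and> (\<forall>q. \<bar>q\<bar> \<le> L \<longrightarrow> objective z \<xi> q \<le> kernel z \<xi>)"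
proof -
  have "continuous_on {- L..L} (objective z \<xi>)"
    by (intro continuous_at_imp_continuous_on ballI DERIV_isCont[OF objective_deriv])
  then obtain p where "p \<in> {- L..L}" "\<And>q. q \<in> {- L..L} \<Longrightarrow> objective z \<xi> q \<le> objective z \<xi> p"
    using continuous_attains_sup[of "{- L..L}" "objective z \<xi>"] L_pos by auto
  then have "\<bar>p\<bar> \<le> L \<and> (\<forall>q. \<bar>q\<bar> \<le> L \<longrightarrow> objective z \<xi> q \<le> objective z \<xi> p)"
    by (auto simp: abs_le_iff)
  then show ?thesis unfolding kernel_def slope_def by (rule someI)
qed

lemma slope_bound: "\<bar>slope z \<xi>\<bar> \<le> L"
  and kernel_ge: "\<bar>q\<bar> \<le> L \<Longrightarrow> objective z \<xi> q \<le> kernel z \<xi>"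
  using slope_props by auto

lemma slope_variational:
  assumes "\<bar>q\<bar> \<le> L"
  shows "(z - \<delta> * slope z \<xi> + \<xi> * H' (slope z \<xi>)) * (q - slope z \<xi>) \<le> 0"
proof (rule DERIV_at_segment_max[OF objective_deriv])
  fix s :: real assume s: "0 \<le> s" "s \<le> 1"
  have "(1 - s) *\<^sub>R slope z \<xi> + s *\<^sub>R q \<in> {- L..L}"
    by (rule convexD_alt[of "{- L..L}"]) (use s assms slope_bound[of z \<xi>] in auto)
  then have "\<bar>slope z \<xi> + s * (q - slope z \<xi>)\<bar> \<le> L" by (auto simp: algebra_simps)
  then show "objective z \<xi> (slope z \<xi> + s * (q - slope z \<xi>)) \<le> objective z \<xi> (slope z \<xi>)"
    using kernel_ge by (simp add: kernel_def)
qed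

text \<open>Each maximizer is a competitor in the variational inequality of the other; the sum of
  the two plays strong concavity off against the change of data. The \<xi>-terms are split so that
  the Lipschitz bound of \<open>H'\<close> multiplies \<xi> and the plain bound \<open>B\<close>
  multiplies \<xi>' - \<xi>. Hence only \<xi> must be small, while \<xi>' is arbitrary.\<close>

lemma slope_lipschitz:
  assumes "\<bar>\<xi>\<bar> \<le> r"
  shows "\<bar>slope z' \<xi>' - slope z \<xi>\<bar> \<le> (\<bar>z' - z\<bar> + B * \<bar>\<xi>' - \<xi>\<bar>) / \<mu>"
proof -
  define p p' where "p = slope z \<xi>" and "p' = slope z' \<xi>'"
  have b: "\<bar>p\<bar> \<le> L" "\<bar>p'\<bar> \<le> L" using slope_bound by (auto simp: p_def p'_def)
  have v: "(z - \<delta> * p + \<xi> * H' p) * (p' - p) \<le> 0"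
    "(z' - \<delta> * p' + \<xi>' * H' p') * (p - p') \<le> 0"
    using slope_variational b by (auto simp: p_def p'_def)
  have a1: "(z' - z) * (p' - p) \<le> \<bar>z' - z\<bar> * \<bar>p' - p\<bar>"
    by (simp flip: abs_mult)
  have a2: "(\<xi>' - \<xi>) * H' p' * (p' - p) \<le> (B * \<bar>\<xi>' - \<xi>\<bar>) * \<bar>p' - p\<bar>"
  proof -
    have "(\<xi>' - \<xi>) * H' p' * (p' - p) \<le> \<bar>\<xi>' - \<xi>\<bar> * \<bar>H' p'\<bar> * \<bar>p' - p\<bar>"
      by (simp flip: abs_mult)
    also have "\<dots> \<le> \<bar>\<xi>' - \<xi>\<bar> * B * \<bar>p' - p\<bar>"
      by (intro mult_right_mono mult_left_mono H'_bound) auto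
    finally show ?thesis by (simp add: mult_ac)
  qed
  have a3: "\<xi> * (H' p' - H' p) * (p' - p) \<le> (r * K) * \<bar>p' - p\<bar>\<^sup>2"
  proof -
    have "\<xi> * (H' p' - H' p) * (p' - p) \<le> \<bar>\<xi>\<bar> * \<bar>H' p' - H' p\<bar> * \<bar>p' - p\<bar>"
      by (simp flip: abs_mult)
    also have "\<dots> \<le> r * (K * \<bar>p' - p\<bar>) * \<bar>p' - p\<bar>"
      by (intro mult_right_mono mult_mono H'_lipschitz b assms) (use assms in auto)
    finally show ?thesis by (simp add: power2_eq_square mult_ac)
  qed
  have "\<delta> * (p' - p)\<^sup>2 \<le> (z' - z) * (p' - p) + (\<xi>' - \<xi>) * H' p' * (p' - p)
      + \<xi> * (H' p' - H' p) * (p' - p)"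
    using v by (simp add: algebra_simps power2_eq_square)
  moreover have "(r * K + \<mu>) * (p' - p)\<^sup>2 \<le> \<delta> * (p' - p)\<^sup>2"
    by (intro mult_right_mono nondegenerate) auto
  ultimately have "\<mu> * \<bar>p' - p\<bar>\<^sup>2 \<le> (\<bar>z' - z\<bar> + B * \<bar>\<xi>' - \<xi>\<bar>) * \<bar>p' - p\<bar>"
    using a1 a2 a3 by (simp add: algebra_simps)
  then have "(\<mu> * \<bar>p' - p\<bar>) * \<bar>p' - p\<bar> \<le> (\<bar>z' - z\<bar> + B * \<bar>\<xi>' - \<xi>\<bar>) * \<bar>p' - p\<bar>"
    by (simp only: power2_eq_square mult.assoc)
  then have "\<mu> * \<bar>p' - p\<bar> \<le> \<bar>z' - z\<bar> + B * \<bar>\<xi>' - \<xi>\<bar>"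
    using B_nonneg mult_right_le_imp_le by (cases "p' = p") auto
  then show ?thesis using \<mu>_pos by (simp add: p_def p'_def field_simps)
qed

text \<open>The maximizer at one point competes at every other point, and the objective is affine in
  \<open>(z, \<xi>)\<close>. This is convexity with an explicit subgradient, valid for all
  \<xi>.\<close>

lemma kernel_tangent:
  "kernel z \<xi> + slope z \<xi> * (z' - z) + H (slope z \<xi>) * (\<xi>' - \<xi>) \<le> kernel z' \<xi>'"
  using kernel_ge[OF slope_bound[of z \<xi>], of z' \<xi>']
  by (simp add: kernel_def objective_def algebra_simps)

text \<open>The tangents at \<open>z\<close> and at \<open>z + e\<close> trap the difference
  quotient between the two slopes, which differ by at most
  \<open>\<bar>e\<bar> / \<mu>\<close>.\<close>

lemma kernel_deriv_z:
  assumes "\<bar>\<xi>\<bar> \<le> r"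
  shows "((\<lambda>z. kernel z \<xi>) has_real_derivative slope z \<xi>) (at z)"
proof -
  have "\<bar>(kernel (z + e) \<xi> - kernel z \<xi>) / e - slope z \<xi>\<bar> \<le> \<bar>e\<bar> / \<mu>" if "e \<noteq> 0" for e
  proof -
    have "\<bar>kernel (z + e) \<xi> - kernel z \<xi> - slope z \<xi> * e\<bar> \<le> \<bar>(slope (z + e) \<xi> - slope z \<xi>) * e\<bar>"
      using kernel_tangent[of z \<xi> "z + e" \<xi>] kernel_tangent[of "z + e" \<xi> z \<xi>]
      by (simp add: algebra_simps)
    also have "\<dots> \<le> \<bar>e\<bar> / \<mu> * \<bar>e\<bar>"
      unfolding abs_mult using slope_lipschitz[OF assms, of "z + e" \<xi> z]
      by (intro mult_right_mono) auto
    finally have "\<bar>kernel (z + e) \<xi> - kernel z \<xi> - slope z \<xi> * e\<bar> / \<bar>e\<bar> \<le> \<bar>e\<bar> / \<mu>"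
      using that by (simp add: field_simps)
    moreover have "(kernel (z + e) \<xi> - kernel z \<xi>) / e - slope z \<xi>
        = (kernel (z + e) \<xi> - kernel z \<xi> - slope z \<xi> * e) / e"
      using that by (simp add: field_simps)
    ultimately show ?thesis by simp
  qed
  then have "\<forall>\<^sub>F e in at 0. norm ((kernel (z + e) \<xi> - kernel z \<xi>) / e - slope z \<xi>) \<le> \<bar>e\<bar> / \<mu>"
    by (auto simp: eventually_at intro!: exI[of _ 1])
  moreover have "((\<lambda>e. \<bar>e\<bar> / \<mu>) \<longlongrightarrow> 0) (at 0)"
    using \<mu>_pos by (auto intro!: tendsto_eq_intros)
  ultimately have "((\<lambda>e. (kernel (z + e) \<xi> - kernel z \<xi>) / e - slope z \<xi>) \<longlongrightarrow> 0) (at 0)"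
    by (rule Lim_null_comparison)
  then show ?thesis unfolding DERIV_def by (rule Lim_null[THEN iffD2])
qed

text \<open>The same trapping in the \<xi>-direction, an envelope theorem. Together with
  \<open>kernel_deriv_z\<close> it says that the kernel solves the equation classically, with \<xi>
  as time.\<close>

lemma kernel_deriv_\<xi>:
  assumes "\<bar>\<xi>\<bar> < r"
  shows "((\<lambda>\<xi>. kernel z \<xi>) has_real_derivative H (slope z \<xi>)) (at \<xi>)"
proof -
  have "\<bar>(kernel z (\<xi> + e) - kernel z \<xi>) / e - H (slope z \<xi>)\<bar> \<le> B * (B * \<bar>e\<bar> / \<mu>)"
    if "e \<noteq> 0" for e
  proof -
    have "\<bar>kernel z (\<xi> + e) - kernel z \<xi> - H (slope z \<xi>) * e\<bar>
        \<le> \<bar>(H (slope z (\<xi> + e)) - H (slope z \<xi>)) * e\<bar>"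
      using kernel_tangent[of z \<xi> z "\<xi> + e"] kernel_tangent[of z "\<xi> + e" z \<xi>]
      by (simp add: algebra_simps)
    also have "\<dots> \<le> B * \<bar>slope z (\<xi> + e) - slope z \<xi>\<bar> * \<bar>e\<bar>"
      unfolding abs_mult by (intro mult_right_mono H_lipschitz) auto
    also have "\<dots> \<le> B * (B * \<bar>e\<bar> / \<mu>) * \<bar>e\<bar>"
      using slope_lipschitz[of \<xi> z "\<xi> + e" z] assms
      by (intro mult_right_mono mult_left_mono B_nonneg) auto
    finally have "\<bar>kernel z (\<xi> + e) - kernel z \<xi> - H (slope z \<xi>) * e\<bar> / \<bar>e\<bar> \<le> B * (B * \<bar>e\<bar> / \<mu>)"
      using that by (simp add: field_simps)
    moreover have "(kernel z (\<xi> + e) - kernel z \<xi>) / e - H (slope z \<xi>)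
        = (kernel z (\<xi> + e) - kernel z \<xi> - H (slope z \<xi>) * e) / e"
      using that by (simp add: field_simps)
    ultimately show ?thesis by simp
  qed
  then have "\<forall>\<^sub>F e in at 0. norm ((kernel z (\<xi> + e) - kernel z \<xi>) / e - H (slope z \<xi>))
      \<le> B * (B * \<bar>e\<bar> / \<mu>)"
    by (auto simp: eventually_at intro!: exI[of _ 1])
  moreover have "((\<lambda>e. B * (B * \<bar>e\<bar> / \<mu>)) \<longlongrightarrow> 0) (at 0)"
    using \<mu>_pos by (auto intro!: tendsto_eq_intros)
  ultimately have "((\<lambda>e. (kernel z (\<xi> + e) - kernel z \<xi>) / e - H (slope z \<xi>)) \<longlongrightarrow> 0) (at 0)"
    by (rule Lim_null_comparison)
  then show ?thesis unfolding DERIV_def by (rule Lim_null[THEN iffD2])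
qed

lemma continuous_on_slope:
  assumes "continuous_on S f" "continuous_on S \<zeta>" "\<And>s. s \<in> S \<Longrightarrow> \<bar>\<zeta> s\<bar> \<le> r"
  shows "continuous_on S (\<lambda>s. slope (f s) (\<zeta> s))"
  unfolding continuous_on_def
proof
  fix s assume s: "s \<in> S"
  have "((\<lambda>y. (\<bar>f y - f s\<bar> + B * \<bar>\<zeta> y - \<zeta> s\<bar>) / \<mu>) \<longlongrightarrow> 0) (at s within S)"
    using assms(1,2) s \<mu>_pos by (auto simp: continuous_on_def intro!: tendsto_eq_intros)
  moreover have "\<forall>\<^sub>F y in at s within S.
      norm (slope (f y) (\<zeta> y) - slope (f s) (\<zeta> s)) \<le> (\<bar>f y - f s\<bar> + B * \<bar>\<zeta> y - \<zeta> s\<bar>) / \<mu>"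
    using slope_lipschitz[OF assms(3)[OF s]] by (auto intro!: always_eventually)
  ultimately have "((\<lambda>y. slope (f y) (\<zeta> y) - slope (f s) (\<zeta> s)) \<longlongrightarrow> 0) (at s within S)"
    by (rule Lim_null_comparison[rotated])
  then show "((\<lambda>s. slope (f s) (\<zeta> s)) \<longlongrightarrow> slope (f s) (\<zeta> s)) (at s within S)"
    by (rule Lim_null[THEN iffD2])
qed

lemma kernel_lipschitz:
  assumes "\<And>p. \<bar>p\<bar> \<le> L \<Longrightarrow> \<bar>H p\<bar> \<le> A"
  shows "\<bar>kernel z' \<xi>' - kernel z \<xi>\<bar> \<le> L * \<bar>z' - z\<bar> + A * \<bar>\<xi>' - \<xi>\<bar>"
proof -
  have le: "kernel z \<xi> - kernel z' \<xi>' \<le> L * \<bar>z' - z\<bar> + A * \<bar>\<xi>' - \<xi>\<bar>" for z z' \<xi> \<xi>'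
  proof -
    have "\<bar>slope z \<xi> * (z' - z)\<bar> \<le> L * \<bar>z' - z\<bar>"
      unfolding abs_mult by (intro mult_right_mono slope_bound) auto
    moreover have "\<bar>H (slope z \<xi>) * (\<xi>' - \<xi>)\<bar> \<le> A * \<bar>\<xi>' - \<xi>\<bar>"
      unfolding abs_mult by (intro mult_right_mono assms slope_bound) auto
    ultimately show ?thesis using kernel_tangent[of z \<xi> z' \<xi>'] by linarith
  qed
  show ?thesis using le[of z \<xi> z' \<xi>'] le[of z' \<xi>' z \<xi>] by (simp add: abs_minus_commute abs_le_iff)
qed

lemma H_bounded_on: "\<exists>A\<ge>0. \<forall>p. \<bar>p\<bar> \<le> L \<longrightarrow> \<bar>H p\<bar> \<le> A"
proof (intro exI conjI allI impI)
  show "0 \<le> \<bar>H 0\<bar> + B * L" using B_nonneg L_pos by simp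
  show "\<bar>H p\<bar> \<le> \<bar>H 0\<bar> + B * L" if "\<bar>p\<bar> \<le> L" for p
    using H_lipschitz[of p 0] mult_left_mono[OF that B_nonneg] by simp
qed

lemma continuous_on_kernel:
  assumes "continuous_on S f" "continuous_on S \<zeta>"
  shows "continuous_on S (\<lambda>s. kernel (f s) (\<zeta> s))"
  unfolding continuous_on_def
proof
  fix s assume s: "s \<in> S"
  obtain A where A: "0 \<le> A" "\<And>p. \<bar>p\<bar> \<le> L \<Longrightarrow> \<bar>H p\<bar> \<le> A" using H_bounded_on by blast
  have "((\<lambda>y. L * \<bar>f y - f s\<bar> + A * \<bar>\<zeta> y - \<zeta> s\<bar>) \<longlongrightarrow> 0) (at s within S)"
    using assms(1,2) s by (auto simp: continuous_on_def intro!: tendsto_eq_intros)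
  moreover have "\<forall>\<^sub>F y in at s within S.
      norm (kernel (f y) (\<zeta> y) - kernel (f s) (\<zeta> s)) \<le> L * \<bar>f y - f s\<bar> + A * \<bar>\<zeta> y - \<zeta> s\<bar>"
    using kernel_lipschitz[OF A(2)] by (auto intro!: always_eventually)
  ultimately have "((\<lambda>y. kernel (f y) (\<zeta> y) - kernel (f s) (\<zeta> s)) \<longlongrightarrow> 0) (at s within S)"
    by (rule Lim_null_comparison[rotated])
  then show "((\<lambda>s. kernel (f s) (\<zeta> s)) \<longlongrightarrow> kernel (f s) (\<zeta> s)) (at s within S)"
    by (rule Lim_null[THEN iffD2])
qed

text \<open>The competitor is \<open>L\<close> or \<open>- L\<close>, according to the sign of
  \<open>z\<close>. The linear growth confines the maximum in the comparison argument; at \<xi> = 0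
  the bound also starts the induction over the time steps.\<close>

lemma kernel_coercive:
  assumes "\<And>p. \<bar>p\<bar> \<le> L \<Longrightarrow> \<bar>H p\<bar> \<le> A"
  shows "L * \<bar>z\<bar> - \<delta> * L\<^sup>2 / 2 - A * \<bar>\<xi>\<bar> \<le> kernel z \<xi>"
proof -
  define p where "p = (if 0 \<le> z then L else - L)"
  have p: "\<bar>p\<bar> \<le> L" "p * z = L * \<bar>z\<bar>" "p\<^sup>2 = L\<^sup>2" using L_pos by (auto simp: p_def)
  have "\<bar>\<xi> * H p\<bar> \<le> \<bar>\<xi>\<bar> * A" unfolding abs_mult by (intro mult_left_mono assms p) auto
  then show ?thesis using kernel_ge[OF p(1), of z \<xi>] p by (simp add: objective_def mult.commute)
qed


section \<open>Admissibility of the kernel along a path as a test function\<close>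

lemma kernel_C_C11:
  assumes \<zeta>: "continuous_on I \<zeta>" "\<And>t. t \<in> I \<Longrightarrow> \<bar>\<zeta> t\<bar> \<le> r"
  shows dx_kernel: "\<And>x t. t \<in> I \<Longrightarrow> dx (\<lambda>x t. kernel (x - y) (\<zeta> t)) x t = slope (x - y) (\<zeta> t)"
    and lipschitz_dx_kernel:
      "\<And>t. t \<in> I \<Longrightarrow> (1 / \<mu>)-lipschitz_on UNIV (\<lambda>x. dx (\<lambda>x t. kernel (x - y) (\<zeta> t)) x t)"
    and "C_C11 I (\<lambda>x t. kernel (x - y) (\<zeta> t))"
proof -
  let ?\<Phi> = "\<lambda>x t. kernel (x - y) (\<zeta> t)"
  have D: "((\<lambda>x. ?\<Phi> x t) has_real_derivative slope (x - y) (\<zeta> t)) (at x)" if "t \<in> I" for x t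
    using kernel_deriv_z[OF \<zeta>(2)[OF that], of "x - y"]
      DERIV_shift[of "\<lambda>z. kernel z (\<zeta> t)" "slope (x - y) (\<zeta> t)" x "- y"] by simp
  show dx: "dx ?\<Phi> x t = slope (x - y) (\<zeta> t)" if "t \<in> I" for x t
    using DERIV_imp_deriv[OF D[OF that]] by (simp add: dx_def)
  show lip: "(1 / \<mu>)-lipschitz_on UNIV (\<lambda>x. dx ?\<Phi> x t)" if "t \<in> I" for t
  proof (rule lipschitz_onI)
    show "dist (dx ?\<Phi> x t) (dx ?\<Phi> x' t) \<le> 1 / \<mu> * dist x x'" for x x'
      using slope_lipschitz[OF \<zeta>(2)[OF that], of "x - y" "\<zeta> t" "x' - y"]
      by (simp add: dx that dist_real_def)
  qed (use \<mu>_pos in simp)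
  have cz: "continuous_on (UNIV \<times> I) (\<lambda>z::real \<times> real. \<zeta> (snd z))"
    by (rule continuous_on_compose2[OF \<zeta>(1)]) (auto intro!: continuous_intros)
  have "continuous_on (UNIV \<times> I) (\<lambda>z. kernel (fst z - y) (\<zeta> (snd z)))"
    by (intro continuous_on_kernel cz continuous_intros)
  moreover have "continuous_on (UNIV \<times> I) (\<lambda>z. slope (fst z - y) (\<zeta> (snd z)))"
    by (intro continuous_on_slope cz continuous_intros) (use \<zeta>(2) in auto)
  then have "continuous_on (UNIV \<times> I) (\<lambda>z. dx ?\<Phi> (fst z) (snd z))"
    by (rule continuous_on_eq) (auto simp: dx)
  moreover have "\<exists>B. \<forall>t\<in>X. B-lipschitz_on UNIV (\<lambda>x. dx ?\<Phi> x t)" if "X \<subseteq> I" for X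
    using lip that by blast
  moreover have "(\<lambda>x. ?\<Phi> x t) field_differentiable at x" if "t \<in> I" for x t
    using D[OF that] field_differentiable_def by blast
  ultimately show "C_C11 I ?\<Phi>"
    unfolding C_C11_def case_prod_unfold by simp
qed

lemma C11_solution_kernel:
  assumes W: "continuous_on {a..b} W" and r: "\<And>t. t \<in> {a..b} \<Longrightarrow> \<bar>W t - c\<bar> + \<eta> \<le> r" and \<eta>: "0 < \<eta>"
  shows "C11_solution H W {a<..<b} (\<lambda>x t. kernel (x - y) (W t - c))"
proof -
  define I where "I = {a<..<b}"
  have "\<exists>g. real_polynomial_function g \<and> (\<forall>t\<in>{a..b}. \<bar>W t - g t\<bar> < \<eta> / Suc n)" for n
    using Stone_Weierstrass_real_polynomial_function[OF compact_Icc W, of "\<eta> / Suc n"] \<eta>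
    by (metis divide_pos_pos of_nat_0_less_iff zero_less_Suc)
  then obtain V where V: "\<And>n. real_polynomial_function (V n)"
    "\<And>n t. t \<in> I \<Longrightarrow> \<bar>V n t - W t\<bar> < \<eta> / Suc n"
    unfolding I_def by (metis abs_minus_commute greaterThanLessThan_subseteq_atLeastAtMost_iff order_refl subsetD)
  obtain V' where V': "\<And>n. real_polynomial_function (V' n)"
    "\<And>n t. (V n has_real_derivative V' n t) (at t)"
    using has_real_derivative_polynomial_function[OF V(1)] by metis
  have cont: "continuous_on S (V n)" "continuous_on S (V' n)" for S n
    using continuous_on_polymonial_function V(1) V'(1) by (auto simp: real_polynomial_function_eq)
  have W_range: "\<bar>W t - c\<bar> \<le> r" if "t \<in> I" for t
    using r[of t] that \<eta> by (auto simp: I_def)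
  \<comment> \<open>The margin \<eta> absorbs the approximation error, so all approximating paths
    stay where the slope has the Lipschitz constant \<open>1 / \<mu>\<close>, the same for every
    \<open>n\<close>.\<close>
  have V_range: "\<bar>V n t - c\<bar> < r" if "t \<in> I" for n t
  proof -
    have "\<eta> / Suc n \<le> \<eta>" using \<eta> by (simp add: field_simps)
    then show ?thesis using V(2)[OF that, of n] r[of t] that by (auto simp: I_def)
  qed
  have W_I: "continuous_on I (\<lambda>t. W t - c)"
    using W by (auto simp: I_def intro!: continuous_intros intro: continuous_on_subset)
  have V_I: "continuous_on I (\<lambda>t. V n t - c)" for n
    by (intro continuous_intros cont)
  obtain A where A: "0 \<le> A" "\<And>p. \<bar>p\<bar> \<le> L \<Longrightarrow> \<bar>H p\<bar> \<le> A" using H_bounded_on by blast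
  let ?\<Phi> = "\<lambda>x t. kernel (x - y) (W t - c)"
  let ?\<Phi>n = "\<lambda>n x t. kernel (x - y) (V n t - c)"
  have V_lim: "(\<lambda>n. C * (\<eta> / Suc n)) \<longlonglongrightarrow> 0" for C
    using tendsto_mult[OF tendsto_const[of C] tendsto_mult[OF tendsto_const[of \<eta>] LIMSEQ_inverse_real_of_nat]]
    by (simp add: divide_inverse)
  show ?thesis unfolding C11_solution_def I_def[symmetric]
  proof (intro conjI exI[of _ V] exI[of _ ?\<Phi>n] allI ballI impI)
    show "C_C11 I ?\<Phi>" by (rule kernel_C_C11(3)[OF W_I W_range])
    show "V n C1_differentiable_on I" for n
      unfolding C1_differentiable_on_def
      using V'(2) cont
      by (auto simp: has_real_derivative_iff_has_vector_derivative intro!: exI[of _ "V' n"])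
    show "uniform_limit I V W sequentially"
      by (rule uniform_limit_rateI[OF _ V_lim[of 1]]) (use V(2) in \<open>auto intro: less_imp_le\<close>)
    show "C_C11 I (?\<Phi>n n)" for n
      by (rule kernel_C_C11(3)[OF V_I]) (use V_range in \<open>auto intro: less_imp_le\<close>)
    have lip: "(1 / \<mu>)-lipschitz_on UNIV (\<lambda>x. dx (?\<Phi>n n) x t)" if "t \<in> I" for n t
      by (rule lipschitz_dx_kernel[OF V_I]) (use V_range that in \<open>auto intro: less_imp_le\<close>)
    show "\<exists>B. \<forall>n. \<forall>t\<in>X. B-lipschitz_on UNIV (\<lambda>x. dx (?\<Phi>n n) x t)"
      if "compact X \<and> X \<subseteq> I" for X
      using that lip by blast
    have dxn: "dx (?\<Phi>n n) x t = slope (x - y) (V n t - c)" if "t \<in> I" for n x t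
      by (rule dx_kernel[OF V_I]) (use V_range that in \<open>auto intro: less_imp_le\<close>)
    show "((\<lambda>s. ?\<Phi>n n x s) has_real_derivative H (dx (?\<Phi>n n) x t) * deriv (V n) t) (at t)"
      if "t \<in> I" for n x t
      unfolding dxn[OF that] DERIV_imp_deriv[OF V'(2)]
      by (rule DERIV_chain2[where f = "kernel (x - y)" and g = "\<lambda>t. V n t - c", OF kernel_deriv_\<xi>[OF V_range[OF that]]])
        (auto intro!: derivative_eq_intros V'(2))
    fix X :: "(real \<times> real) set" assume X: "compact X \<and> X \<subseteq> UNIV \<times> I"
    show "uniform_limit X (\<lambda>n (x, t). ?\<Phi>n n x t) (\<lambda>(x, t). ?\<Phi> x t) sequentially"
    proof (rule uniform_limit_rateI[OF _ V_lim[of A]], clarify)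
      fix n x t assume "(x, t) \<in> X"
      then have "t \<in> I" using X by auto
      have "\<bar>?\<Phi>n n x t - ?\<Phi> x t\<bar> \<le> A * \<bar>V n t - W t\<bar>"
        using kernel_lipschitz[OF A(2), of "x - y" "V n t - c" "x - y" "W t - c"] by simp
      also have "\<dots> \<le> A * (\<eta> / Suc n)"
        by (intro mult_left_mono A less_imp_le V \<open>t \<in> I\<close>)
      finally show "\<bar>?\<Phi>n n x t - ?\<Phi> x t\<bar> \<le> A * (\<eta> / real (Suc n))" .
    qed
    show "uniform_limit X (\<lambda>n (x, t). dx (?\<Phi>n n) x t) (\<lambda>(x, t). dx ?\<Phi> x t) sequentially"
    proof (rule uniform_limit_rateI[OF _ V_lim[of "B / \<mu>"]], clarify)
      fix n x t assume "(x, t) \<in> X"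
      then have t: "t \<in> I" using X by auto
      have "dx ?\<Phi> x t = slope (x - y) (W t - c)"
        by (rule dx_kernel[OF W_I W_range t])
      then have "\<bar>dx (?\<Phi>n n) x t - dx ?\<Phi> x t\<bar> \<le> B / \<mu> * \<bar>V n t - W t\<bar>"
        using slope_lipschitz[OF W_range[OF t], of "x - y" "V n t - c" "x - y"]
        by (simp add: dxn[OF t])
      also have "\<dots> \<le> B / \<mu> * (\<eta> / Suc n)"
        using B_nonneg \<mu>_pos by (intro mult_left_mono less_imp_le[OF V(2)[OF t]]) auto
      finally show "\<bar>dx (?\<Phi>n n) x t - dx ?\<Phi> x t\<bar> \<le> B / \<mu> * (\<eta> / real (Suc n))" .
    qed
  qed
qed

end


section \<open>Lipschitz functions with an almost everywhere derivative bound\<close>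

text \<open>If the mean slope exceeded some \<open>L' > L\<close>, then \<open>f\<close> minus the
  line of slope \<open>L'\<close> would be larger at \<open>b\<close> than at \<open>a\<close>. This
  function is Lipschitz, so it maps \<open>N\<close> to a null set, and some level strictly between
  its end values is taken only outside \<open>N\<close>. At the last crossing of that level its
  derivative is negative, which forces a later crossing.\<close>

lemma slope_bound_from_ae_deriv_bound:
  fixes f :: "real \<Rightarrow> real"
  assumes lip: "K-lipschitz_on UNIV f" and N: "negligible N"
    and D: "\<And>x. x \<notin> N \<Longrightarrow> \<exists>D\<le>L. (f has_real_derivative D) (at x)"
    and ab: "a < b"
  shows "f b - f a \<le> L * (b - a)"
proof (rule ccontr)
  assume "\<not> f b - f a \<le> L * (b - a)"
  then have "L < (f b - f a) / (b - a)" using ab by (simp add: field_simps)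
  then obtain L' where L': "L < L'" "L' < (f b - f a) / (b - a)" using dense by blast
  define \<phi> where "\<phi> x = f x - L' * x" for x
  have \<phi>_ab: "\<phi> a < \<phi> b" using L'(2) ab by (simp add: \<phi>_def field_simps)
  have f_cont: "continuous_on S f" for S
    using lipschitz_on_continuous_on[OF lip] continuous_on_subset by blast
  have cont: "continuous_on S \<phi>" for S
    unfolding \<phi>_def by (intro continuous_intros f_cont)
  have \<phi>_lip: "\<bar>\<phi> y - \<phi> x\<bar> \<le> (K + \<bar>L'\<bar>) * \<bar>y - x\<bar>" for x y
  proof -
    have "\<bar>\<phi> y - \<phi> x\<bar> \<le> \<bar>f y - f x\<bar> + \<bar>L' * (y - x)\<bar>"
      by (simp add: \<phi>_def algebra_simps)
    also have "\<bar>f y - f x\<bar> \<le> K * \<bar>y - x\<bar>"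
      using lipschitz_onD[OF lip, of y x] by (simp add: dist_real_def)
    finally show ?thesis by (simp add: abs_mult distrib_right)
  qed
  have "negligible (\<phi> ` N)"
    by (rule negligible_locally_Lipschitz_image[OF _ N])
      (use \<phi>_lip in \<open>auto intro!: exI[of _ UNIV] exI[of _ "K + \<bar>L'\<bar>"]\<close>)
  moreover have "\<not> negligible {\<phi> a<..<\<phi> b}"
    using \<phi>_ab open_not_negligible[of "{\<phi> a<..<\<phi> b}"] by simp
  ultimately have "\<not> {\<phi> a<..<\<phi> b} \<subseteq> \<phi> ` N"
    using negligible_subset by blast
  then obtain y where y: "\<phi> a < y" "y < \<phi> b" "y \<notin> \<phi> ` N"
    by (meson greaterThanLessThan_iff subsetI)
  \<comment> \<open>At the last point below the level \<open>y\<close>, which avoids the image of \<open>N\<close>, \<open>\<phi>\<close> cannot decrease.\<close>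
  define S where "S = {x \<in> {a..b}. \<phi> x \<le> y}"
  have "compact S"
  proof -
    have "closed S" unfolding S_def
      using continuous_on_closed_Collect_le[OF cont continuous_on_const, of "{a..b}" y] by simp
    moreover have "bounded S"
      by (rule bounded_subset[OF bounded_closed_interval[of a b]]) (auto simp: S_def)
    ultimately show ?thesis by (simp add: compact_eq_bounded_closed)
  qed
  moreover have "a \<in> S" using y(1) ab by (simp add: S_def)
  ultimately obtain c where c: "c \<in> S" "\<And>x. x \<in> S \<Longrightarrow> x \<le> c"
    using compact_attains_sup[of S] by auto
  have "c < b" using c(1) y(2) by (auto simp: S_def less_le)
  have "\<exists>x\<ge>c. x \<le> b \<and> \<phi> x = y"
    by (rule IVT') (use c(1) y(2) \<open>c < b\<close> cont in \<open>auto simp: S_def\<close>)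
  then obtain c' where c': "c \<le> c'" "c' \<le> b" "\<phi> c' = y" by blast
  then have "c' \<in> S" using c(1) by (auto simp: S_def)
  with c' c(2) have \<phi>c: "\<phi> c = y" by force
  with y(3) have "c \<notin> N" by blast
  then obtain D where "D \<le> L" "(f has_real_derivative D) (at c)" using D by blast
  then have "(\<phi> has_real_derivative D - L') (at c)" "D - L' < 0"
    unfolding \<phi>_def using L'(1) by (auto intro!: derivative_eq_intros)
  then obtain d where d: "0 < d" "\<And>e. 0 < e \<Longrightarrow> e < d \<Longrightarrow> \<phi> (c + e) < \<phi> c"
    using DERIV_neg_dec_right by blast
  define e where "e = min (d / 2) (b - c)"
  have e: "0 < e" "e < d" "c + e \<le> b" using d(1) \<open>c < b\<close> by (auto simp: e_def min_def)
  have "c + e \<in> S" using d(2)[OF e(1,2)] \<phi>c e c(1) by (auto simp: S_def)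
  then show False using c(2) e(1) by force
qed

lemma lipschitz_with_deriv_boundD:
  assumes "lipschitz_with_deriv_bound L f"
  shows "\<bar>f x - f y\<bar> \<le> L * \<bar>x - y\<bar>"
proof -
  obtain K where K: "K-lipschitz_on UNIV f"
    and AE: "AE x in lborel. f field_differentiable at x \<and> \<bar>deriv f x\<bar> \<le> L"
    using assms by (auto simp: lipschitz_with_deriv_bound_def)
  obtain N where N: "negligible N"
    and D: "\<And>x. x \<notin> N \<Longrightarrow> f field_differentiable at x \<and> \<bar>deriv f x\<bar> \<le> L"
    using AE_completion[OF AE] unfolding eventually_ae_filter_negligible by blast
  have K': "K-lipschitz_on UNIV (\<lambda>x. - f x)"
    using K by (auto simp: lipschitz_on_def dist_real_def abs_minus_commute)
  have up: "f b - f a \<le> L * (b - a)" if "a < b" for a b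
  proof (rule slope_bound_from_ae_deriv_bound[OF K N _ that])
    show "\<exists>D\<le>L. (f has_real_derivative D) (at x)" if "x \<notin> N" for x
      using D[OF that] DERIV_deriv_iff_field_differentiable by (metis abs_le_D1)
  qed
  have down: "- f b - - f a \<le> L * (b - a)" if "a < b" for a b
  proof (rule slope_bound_from_ae_deriv_bound[OF K' N _ that])
    show "\<exists>D\<le>L. ((\<lambda>x. - f x) has_real_derivative D) (at x)" if "x \<notin> N" for x
      using D[OF that] DERIV_deriv_iff_field_differentiable DERIV_minus by (metis abs_le_D2)
  qed
  show ?thesis using up[of x y] down[of x y] up[of y x] down[of y x]
    by (cases x y rule: linorder_cases) (auto simp: abs_if algebra_simps)
qed


section \<open>Monotonicity of the scheme and the interpolated path\<close>

text \<open>Let \<open>a\<close> and \<open>b\<close> be the nonnegative gaps at the two neighbours.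
  The flux changes by at most \<theta>/2 times \<open>\<bar>b - a\<bar>\<close>, and the averaging
  term gains \<theta>/2 times \<open>a + b\<close>, which dominates. The value at the centre enters
  with the weight \<open>1 - \<theta>\<close>, nonnegative by assumption; constants pass through the
  scheme unchanged.\<close>

lemma S_op_mono:
  assumes lip: "\<And>p q. \<bar>H p - H q\<bar> \<le> B * \<bar>p - q\<bar>"
    and cfl: "B * \<bar>\<zeta> t - \<zeta> s\<bar> \<le> \<theta> * h" and h: "0 < h" and \<theta>: "\<theta> \<le> 1"
    and le: "\<And>y. w y \<le> v y + m"
  shows "S_op H \<theta> h t s \<zeta> w x \<le> S_op H \<theta> h t s \<zeta> v x + m"
proof -
  define a b where "a = v (x + h) + m - w (x + h)" and "b = v (x - h) + m - w (x - h)"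
  have ab: "0 \<le> a" "0 \<le> b" using le[of "x + h"] le[of "x - h"] by (auto simp: a_def b_def)
  define p q where "p = (w (x + h) - w (x - h)) / (2 * h)" and "q = (v (x + h) - v (x - h)) / (2 * h)"
  have pq: "p - q = (b - a) / (2 * h)"
    by (simp add: p_def q_def a_def b_def diff_divide_distrib[symmetric])
  have "(H p - H q) * (\<zeta> t - \<zeta> s) \<le> \<bar>H p - H q\<bar> * \<bar>\<zeta> t - \<zeta> s\<bar>" by (simp flip: abs_mult)
  also have "\<dots> \<le> B * \<bar>p - q\<bar> * \<bar>\<zeta> t - \<zeta> s\<bar>" by (intro mult_right_mono lip) auto
  also have "\<dots> = B * \<bar>\<zeta> t - \<zeta> s\<bar> * \<bar>p - q\<bar>" by (simp add: mult_ac)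
  also have "\<dots> \<le> \<theta> * h * \<bar>p - q\<bar>" by (intro mult_right_mono cfl) auto
  also have "\<dots> = \<theta> / 2 * \<bar>b - a\<bar>" using h by (simp add: pq abs_mult)
  also have "\<dots> \<le> \<theta> / 2 * (a + b)"
  proof (rule mult_left_mono)
    \<comment> \<open>The sign of \<theta> is recovered from the step condition: its left side is
      nonnegative and \<open>h\<close> is positive.\<close>
    have "0 \<le> B" using lip[of 0 1] by (auto intro: order_trans[OF abs_ge_zero])
    then have "0 \<le> \<theta> * h" using cfl by (meson abs_ge_zero mult_nonneg_nonneg order_trans)
    then show "0 \<le> \<theta> / 2" using h by (simp add: zero_le_mult_iff)
  qed (use ab in auto)
  finally have "(H p - H q) * (\<zeta> t - \<zeta> s) \<le> \<theta> / 2 * (a + b)" .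
  moreover have "(1 - \<theta>) * w x \<le> (1 - \<theta>) * (v x + m)"
    using \<theta> le by (intro mult_left_mono) auto
  ultimately show ?thesis
    unfolding S_op_def p_def[symmetric] q_def[symmetric]
    by (simp add: a_def b_def algebra_simps add_divide_distrib diff_divide_distrib)
qed

section \<open>Increments of the interpolated path and its distance to \<open>W\<close>\<close>

lemma M_steps_sqrt_le:
  assumes "0 < \<rho>" shows "real (M_steps \<rho>) * sqrt \<rho> \<le> 1"
proof -
  have "\<rho> powr (- 1 / 2) = 1 / sqrt \<rho>"
    using assms powr_minus_divide[of \<rho> "1/2"] by (simp add: powr_half_sqrt)
  moreover have "0 \<le> 1 / sqrt \<rho>" using assms by simp
  ultimately have "real (M_steps \<rho>) \<le> 1 / sqrt \<rho>" by (simp add: M_steps_def)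
  then show ?thesis using assms by (simp add: field_simps)
qed

lemma W_interp_closed_block:
  assumes "0 < \<rho>" "1 \<le> M_steps \<rho>"
    and "real k * real (M_steps \<rho>) * \<rho> \<le> t" "t \<le> (real k + 1) * real (M_steps \<rho>) * \<rho>"
  shows "W_interp W T \<rho> t =
     W (min (real k * real (M_steps \<rho>) * \<rho>) T) +
     (W (min ((real k + 1) * real (M_steps \<rho>) * \<rho>) T) - W (min (real k * real (M_steps \<rho>) * \<rho>) T))
       / (real (M_steps \<rho>) * \<rho>) * (t - real k * real (M_steps \<rho>) * \<rho>)"
proof (cases "t = (real k + 1) * real (M_steps \<rho>) * \<rho>")
  case True
  have p: "0 < real (M_steps \<rho>) * \<rho>" using assms(1,2) by simp
  have "W_interp W T \<rho> t = W (min t T)"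
    using W_interp_block[OF assms(1,2), of "Suc k" t W T] p True by (simp add: algebra_simps)
  moreover have "t - real k * real (M_steps \<rho>) * \<rho> = real (M_steps \<rho>) * \<rho>"
    using True by (simp add: algebra_simps)
  ultimately show ?thesis using p True by simp
next
  case False
  then show ?thesis using W_interp_block assms by simp
qed

lemma modulus_of_continuity_frozen:
  assumes mod: "modulus_of_continuity \<omega> W T" and "0 < T" "0 \<le> s" "0 \<le> t" "\<bar>s - t\<bar> \<le> d"
  shows "\<bar>W (min s T) - W (min t T)\<bar> \<le> \<omega> d"
proof -
  have "\<bar>W (min s T) - W (min t T)\<bar> \<le> \<omega> \<bar>min s T - min t T\<bar>"
    using mod assms(2-4) by (auto simp: modulus_of_continuity_def)
  also have "\<dots> \<le> \<omega> d"
    using mod assms(5) by (auto simp: modulus_of_continuity_def intro!: mono_onD[of "{0..}" \<omega>])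
  finally show ?thesis .
qed

context
  fixes \<omega> W :: "real \<Rightarrow> real" and T \<rho> :: real
  assumes mod: "modulus_of_continuity \<omega> W T" and T: "0 < T"
    and \<rho>: "0 < \<rho>" and M: "1 \<le> M_steps \<rho>"
begin

lemma block_length_le: "real (M_steps \<rho>) * \<rho> \<le> sqrt \<rho>"
  using mult_right_mono[OF M_steps_sqrt_le[OF \<rho>], of "sqrt \<rho>"] \<rho> by (simp add: mult.assoc)

text \<open>The slope on a block of length \<open>M_steps \<rho> * \<rho> \<le> sqrt \<rho>\<close>
  is at most \<open>\<omega> (sqrt \<rho>)\<close> divided by this length; a time step has length
  \<rho>, which leaves the factor \<open>1 / M_steps \<rho>\<close>.\<close>

lemma W_interp_increment:
  assumes t: "real n * \<rho> \<le> t" "t \<le> (real n + 1) * \<rho>"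
  shows "\<bar>W_interp W T \<rho> t - W_interp W T \<rho> (real n * \<rho>)\<bar> \<le> \<omega> (sqrt \<rho>) / real (M_steps \<rho>)"
proof -
  define m k \<tau> where "m = M_steps \<rho>" and "k = n div M_steps \<rho>" and "\<tau> = real (M_steps \<rho>) * \<rho>"
  define \<sigma> where "\<sigma> = (W (min ((real k + 1) * real m * \<rho>) T) - W (min (real k * real m * \<rho>) T)) / \<tau>"
  have \<tau>: "0 < \<tau>" "\<tau> = real m * \<rho>" using \<rho> M by (auto simp: \<tau>_def m_def)
  \<comment> \<open>Block ends are multiples of \<rho>, so step \<open>n\<close> lies entirely in
    block \<open>n div m\<close> and a single affine formula applies to it.\<close>
  have "k * m \<le> n" "n + 1 \<le> (k + 1) * m"
    using M div_times_less_eq_dividend[of n m] dividend_less_times_div[of m n]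
    by (auto simp: m_def k_def mult.commute)
  then have "real (k * m) \<le> real n" "real (n + 1) \<le> real ((k + 1) * m)" by (simp_all only: of_nat_le_iff)
  then have "real (k * m) * \<rho> \<le> real n * \<rho>" "real (n + 1) * \<rho> \<le> real ((k + 1) * m) * \<rho>"
    using \<rho> by (simp_all only: mult_right_mono less_imp_le)
  then have kn: "real k * real m * \<rho> \<le> real n * \<rho>" "(real n + 1) * \<rho> \<le> (real k + 1) * real m * \<rho>"
    by (simp_all add: algebra_simps)
  have V: "W_interp W T \<rho> s = W (min (real k * real m * \<rho>) T) + \<sigma> * (s - real k * real m * \<rho>)"
    if "real n * \<rho> \<le> s" "s \<le> (real n + 1) * \<rho>" for s
    using W_interp_closed_block[OF \<rho> M, of k s W T] that kn by (simp add: \<sigma>_def m_def \<tau>_def)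
  have "real n * \<rho> \<le> (real n + 1) * \<rho>" using \<rho> by (simp add: distrib_right)
  then have "W_interp W T \<rho> t - W_interp W T \<rho> (real n * \<rho>) = \<sigma> * (t - real n * \<rho>)"
    using V[OF t] V[of "real n * \<rho>"] by (simp add: algebra_simps)
  moreover have "\<bar>\<sigma> * (t - real n * \<rho>)\<bar> \<le> \<omega> (sqrt \<rho>) / \<tau> * \<rho>"
    unfolding abs_mult
  proof (intro mult_mono)
    have "\<bar>W (min ((real k + 1) * real m * \<rho>) T) - W (min (real k * real m * \<rho>) T)\<bar> \<le> \<omega> (sqrt \<rho>)"
      using \<rho> T block_length_le
      by (intro modulus_of_continuity_frozen[OF mod]) (auto simp: m_def algebra_simps)
    then show "\<bar>\<sigma>\<bar> \<le> \<omega> (sqrt \<rho>) / \<tau>" using \<tau> by (simp add: \<sigma>_def divide_right_mono)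
    show "0 \<le> \<omega> (sqrt \<rho>) / \<tau>" using mod \<rho> \<tau> by (simp add: modulus_of_continuity_def)
  qed (use t in \<open>auto simp: algebra_simps\<close>)
  ultimately show ?thesis using \<rho> by (simp add: \<tau>(2) m_def)
qed

lemma W_interp_error:
  assumes t: "0 \<le> t" "t \<le> T"
  shows "\<bar>W t - W_interp W T \<rho> t\<bar> \<le> \<omega> (sqrt \<rho>)"
proof -
  define k where "k = nat \<lfloor>t / (real (M_steps \<rho>) * \<rho>)\<rfloor>"
  define \<tau> where "\<tau> = real (M_steps \<rho>) * \<rho>"
  have \<tau>: "0 < \<tau>" "\<tau> \<le> sqrt \<rho>" using \<rho> M block_length_le by (auto simp: \<tau>_def)
  have "real k = real_of_int \<lfloor>t / \<tau>\<rfloor>" using t \<tau> by (simp add: k_def \<tau>_def)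
  then have "real k \<le> t / \<tau>" "t / \<tau> \<le> real k + 1" by linarith+
  then have k: "real k * \<tau> \<le> t" "t \<le> (real k + 1) * \<tau>" using \<tau> by (simp_all add: field_simps)
  define a b s where "a = W (min (real k * \<tau>) T)" and "b = W (min ((real k + 1) * \<tau>) T)"
    and "s = (t - real k * \<tau>) / \<tau>"
  have "W_interp W T \<rho> t = a + (b - a) / \<tau> * (t - real k * \<tau>)"
    using W_interp_closed_block[OF \<rho> M, of k t W T] k
    by (simp add: \<tau>_def a_def b_def mult.assoc)
  also have "(b - a) / \<tau> * (t - real k * \<tau>) = s * (b - a)" by (simp add: s_def)
  finally have V: "W_interp W T \<rho> t = (1 - s) * a + s * b" by (simp add: algebra_simps)
  have s: "0 \<le> s" "s \<le> 1" using k \<tau> by (auto simp: s_def field_simps)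
  have a: "\<bar>W t - a\<bar> \<le> \<omega> (sqrt \<rho>)" and b: "\<bar>W t - b\<bar> \<le> \<omega> (sqrt \<rho>)"
  proof -
    have "\<bar>t - real k * \<tau>\<bar> \<le> sqrt \<rho>" "\<bar>t - (real k + 1) * \<tau>\<bar> \<le> sqrt \<rho>"
      using k \<tau>(2) by (auto simp: distrib_right abs_le_iff)
    then show "\<bar>W t - a\<bar> \<le> \<omega> (sqrt \<rho>)" "\<bar>W t - b\<bar> \<le> \<omega> (sqrt \<rho>)"
      using modulus_of_continuity_frozen[OF mod T t(1), of "real k * \<tau>" "sqrt \<rho>"]
        modulus_of_continuity_frozen[OF mod T t(1), of "(real k + 1) * \<tau>" "sqrt \<rho>"] t \<tau>(1)
      by (auto simp: a_def b_def min_absorb1)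
  qed
  have "\<bar>W t - W_interp W T \<rho> t\<bar> = \<bar>(1 - s) * (W t - a) + s * (W t - b)\<bar>"
    by (simp add: V algebra_simps)
  also have "\<dots> \<le> (1 - s) * \<bar>W t - a\<bar> + s * \<bar>W t - b\<bar>"
    using s abs_triangle_ineq[of "(1 - s) * (W t - a)" "s * (W t - b)"] by (simp add: abs_mult)
  also have "\<dots> \<le> (1 - s) * \<omega> (sqrt \<rho>) + s * \<omega> (sqrt \<rho>)"
    using s a b by (intro add_mono mult_left_mono) auto
  finally show ?thesis by (simp add: algebra_simps)
qed

end


section \<open>Reflection\<close>

lemma dx_uminus:
  assumes "(\<lambda>y. \<Phi> y t) field_differentiable at x"
  shows "dx (\<lambda>x t. - \<Phi> x t) x t = - dx \<Phi> x t"
  using assms by (simp add: dx_def)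

lemma C_C11_uminus:
  assumes "C_C11 I \<Phi>"
  shows "C_C11 I (\<lambda>x t. - \<Phi> x t)"
    and "t \<in> I \<Longrightarrow> dx (\<lambda>x t. - \<Phi> x t) x t = - dx \<Phi> x t"
proof -
  have d: "(\<lambda>y. \<Phi> y t) field_differentiable at x" if "t \<in> I" for x t
    using assms that by (auto simp: C_C11_def)
  show dx: "dx (\<lambda>x t. - \<Phi> x t) x t = - dx \<Phi> x t" if "t \<in> I" for x t
    by (rule dx_uminus[where \<Phi> = \<Phi> and t = t, OF d[OF that]])
  have c: "continuous_on (UNIV \<times> I) (\<lambda>(x, t). \<Phi> x t)" "continuous_on (UNIV \<times> I) (\<lambda>(x, t). dx \<Phi> x t)"
    using assms by (auto simp: C_C11_def)
  have l: "\<exists>B. \<forall>t\<in>X. B-lipschitz_on UNIV (\<lambda>x. dx (\<lambda>x t. - \<Phi> x t) x t)"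
    if X: "compact X" "X \<subseteq> I" for X
  proof -
    obtain B where B: "\<forall>t\<in>X. B-lipschitz_on UNIV (\<lambda>x. dx \<Phi> x t)"
      using assms X unfolding C_C11_def by blast
    have "B-lipschitz_on UNIV (\<lambda>x. dx (\<lambda>x t. - \<Phi> x t) x t)" if "t \<in> X" for t
      using B that X dx[of t] by (auto simp: lipschitz_on_def dist_real_def abs_minus_commute subset_iff)
    then show ?thesis by blast
  qed
  have "continuous_on (UNIV \<times> I) (\<lambda>z. - (case z of (x, t) \<Rightarrow> dx \<Phi> x t))"
    by (intro continuous_intros c)
  then have "continuous_on (UNIV \<times> I) (\<lambda>(x, t). dx (\<lambda>x t. - \<Phi> x t) x t)"
    by (rule continuous_on_eq) (auto simp: dx)
  moreover have "continuous_on (UNIV \<times> I) (\<lambda>(x, t). - \<Phi> x t)"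
    using continuous_on_minus[OF c(1)] by (simp add: case_prod_unfold)
  ultimately show "C_C11 I (\<lambda>x t. - \<Phi> x t)"
    using d l unfolding C_C11_def by (auto intro!: field_differentiable_minus)
qed

text \<open>The approximating paths are kept and the approximating solutions change sign; the two
  sign changes inside the Hamiltonian undo the reflection.\<close>

lemma C11_solution_uminus:
  assumes "C11_solution (\<lambda>p. - H (- p)) W I \<Phi>"
  shows "C11_solution H W I (\<lambda>x t. - \<Phi> x t)"
proof -
  obtain V \<Phi>n where c: "C_C11 I \<Phi>" "\<forall>n. C_C11 I (\<Phi>n n)"
    and V: "\<forall>n. V n C1_differentiable_on I" "uniform_limit I V W sequentially"
    and l: "\<forall>X. compact X \<and> X \<subseteq> I \<longrightarrow>
             (\<exists>B. \<forall>n. \<forall>t\<in>X. B-lipschitz_on UNIV (\<lambda>x. dx (\<Phi>n n) x t))"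
    and e: "\<forall>n x. \<forall>t\<in>I. ((\<lambda>s. \<Phi>n n x s) has_real_derivative
                         - H (- dx (\<Phi>n n) x t) * deriv (V n) t) (at t)"
    and u: "\<forall>X. compact X \<and> X \<subseteq> UNIV \<times> I \<longrightarrow>
             uniform_limit X (\<lambda>n (x, t). \<Phi>n n x t) (\<lambda>(x, t). \<Phi> x t) sequentially \<and>
             uniform_limit X (\<lambda>n (x, t). dx (\<Phi>n n) x t) (\<lambda>(x, t). dx \<Phi> x t) sequentially"
    using assms unfolding C11_solution_def by (elim conjE exE) (rule that; assumption)
  have dxn: "dx (\<lambda>x t. - \<Phi>n n x t) x t = - dx (\<Phi>n n) x t" if "t \<in> I" for n x t
    using C_C11_uminus(2)[OF c(2)[rule_format] that] .
  show ?thesis unfolding C11_solution_def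
  proof (intro conjI exI[of _ V] exI[of _ "\<lambda>n x t. - \<Phi>n n x t"] allI ballI impI)
    show "C_C11 I (\<lambda>x t. - \<Phi> x t)" "C_C11 I (\<lambda>x t. - \<Phi>n n x t)" for n
      using c C_C11_uminus by auto
    show "\<exists>B. \<forall>n. \<forall>t\<in>X. B-lipschitz_on UNIV (\<lambda>x. dx (\<lambda>x t. - \<Phi>n n x t) x t)"
      if X: "compact X \<and> X \<subseteq> I" for X
    proof -
      obtain B where B: "\<forall>n. \<forall>t\<in>X. B-lipschitz_on UNIV (\<lambda>x. dx (\<Phi>n n) x t)"
        using l X by blast
      have "B-lipschitz_on UNIV (\<lambda>x. dx (\<lambda>x t. - \<Phi>n n x t) x t)" if "t \<in> X" for n t
        using B that X dxn[of t n]
        by (auto simp: lipschitz_on_def dist_real_def abs_minus_commute subset_iff)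
      then show ?thesis by blast
    qed
    show "((\<lambda>s. - \<Phi>n n x s) has_real_derivative
        H (dx (\<lambda>x t. - \<Phi>n n x t) x t) * deriv (V n) t) (at t)" if "t \<in> I" for n x t
      using DERIV_minus[OF e[rule_format, OF that, of n x]] dxn[OF that, of n] by simp
    fix X :: "(real \<times> real) set" assume X: "compact X \<and> X \<subseteq> UNIV \<times> I"
    show "uniform_limit X (\<lambda>n (x, t). - \<Phi>n n x t) (\<lambda>(x, t). - \<Phi> x t) sequentially"
      using uniform_limit_uminus[OF u[rule_format, OF X, THEN conjunct1]] by (simp add: case_prod_unfold)
    have "uniform_limit X (\<lambda>n z. - dx (\<Phi>n n) (fst z) (snd z)) (\<lambda>z. - dx \<Phi> (fst z) (snd z)) sequentially"
      using uniform_limit_uminus[OF u[rule_format, OF X, THEN conjunct2]] by (simp add: case_prod_unfold)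
    then show "uniform_limit X (\<lambda>n (x, t). dx (\<lambda>x t. - \<Phi>n n x t) x t)
        (\<lambda>(x, t). dx (\<lambda>x t. - \<Phi> x t) x t) sequentially"
      by (rule uniform_limit_cong'[THEN iffD1, rotated -1])
        (use X dxn C_C11_uminus(2)[OF c(1)] in \<open>auto simp: subset_iff\<close>)
  qed (use V in auto)
qed

text \<open>Negating both \<Phi> and \<psi> turns a local maximum for \<open>- u\<close> into a
  local minimum for \<open>u\<close>, where the supersolution property applies.\<close>

lemma pathwise_subsolution_uminus:
  assumes "pathwise_supersolution H W T u0 u"
  shows "pathwise_subsolution (\<lambda>p. - H (- p)) W T (\<lambda>x. - u0 x) (\<lambda>x t. - u x t)"
  unfolding pathwise_subsolution_def
proof (intro conjI allI impI)
  have lsc: "lower_semicontinuous_on (UNIV \<times> {0..T}) (\<lambda>(x, t). u x t)"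
    and ini: "\<And>x. u0 x \<le> u x 0"
    and test: "\<And>a b \<Phi> \<psi> \<psi>' x0 t0.
        0 \<le> a \<and> a < b \<and> b \<le> T \<and> C1_closed T \<psi> \<psi>' \<and> C11_solution H W {a<..<b} \<Phi> \<and>
        local_min_at (UNIV \<times> {a<..<b}) (\<lambda>(x, t). u x t - \<Phi> x t - \<psi> t) (x0, t0)
        \<Longrightarrow> 0 \<le> \<psi>' t0"
    using assms unfolding pathwise_supersolution_def by blast+
  show "upper_semicontinuous_on (UNIV \<times> {0..T}) (\<lambda>(x, t). - u x t)"
    unfolding upper_semicontinuous_on_def
  proof (intro ballI allI impI)
    fix z :: "real \<times> real" and a
    assume "z \<in> UNIV \<times> {0..T}" "(case z of (x, t) \<Rightarrow> - u x t) < a"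
    then have "\<forall>\<^sub>F y in at z within UNIV \<times> {0..T}. - a < (case y of (x, t) \<Rightarrow> u x t)"
      using lsc unfolding lower_semicontinuous_on_def by (auto simp: minus_less_iff)
    then show "\<forall>\<^sub>F y in at z within UNIV \<times> {0..T}. (case y of (x, t) \<Rightarrow> - u x t) < a"
      by eventually_elim (auto simp: minus_less_iff)
  qed
  show "- u x 0 \<le> - u0 x" for x using ini by simp
  fix a b \<Phi> \<psi> \<psi>' and x0 t0 :: real
  assume A: "0 \<le> a \<and> a < b \<and> b \<le> T \<and> C1_closed T \<psi> \<psi>' \<and>
    C11_solution (\<lambda>p. - H (- p)) W {a<..<b} \<Phi> \<and>
    local_max_at (UNIV \<times> {a<..<b}) (\<lambda>(x, t). - u x t - \<Phi> x t - \<psi> t) (x0, t0)"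
  have "C1_closed T (\<lambda>t. - \<psi> t) (\<lambda>t. - \<psi>' t)"
    using A by (auto simp: C1_closed_def intro!: DERIV_minus continuous_intros)
  moreover have "local_min_at (UNIV \<times> {a<..<b}) (\<lambda>(x, t). u x t - - \<Phi> x t - - \<psi> t) (x0, t0)"
  proof -
    have "(x0, t0) \<in> UNIV \<times> {a<..<b}" and
      "\<forall>\<^sub>F y in at (x0, t0) within UNIV \<times> {a<..<b}.
        (case y of (x, t) \<Rightarrow> - u x t - \<Phi> x t - \<psi> t) \<le> - u x0 t0 - \<Phi> x0 t0 - \<psi> t0"
      using A by (auto simp: local_max_at_def)
    moreover from this(2) have "\<forall>\<^sub>F y in at (x0, t0) within UNIV \<times> {a<..<b}.
        u x0 t0 - - \<Phi> x0 t0 - - \<psi> t0 \<le> (case y of (x, t) \<Rightarrow> u x t - - \<Phi> x t - - \<psi> t)"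
      by eventually_elim auto
    ultimately show ?thesis by (simp add: local_min_at_def)
  qed
  ultimately have "0 \<le> - \<psi>' t0"
    using A C11_solution_uminus[of H W "{a<..<b}" \<Phi>]
    by (intro test[of a b "\<lambda>t. - \<psi> t" "\<lambda>t. - \<psi>' t" "\<lambda>x t. - \<Phi> x t" x0]) auto
  then show "\<psi>' t0 \<le> 0" by simp
qed

text \<open>The central difference and the averaging term are linear in \<open>w\<close>, so
  reflecting \<open>H\<close> is all that a change of sign requires.\<close>

lemma S_op_uminus:
  "S_op (\<lambda>p. - H (- p)) \<theta> h t s \<zeta> (\<lambda>x. - w x) = (\<lambda>x. - S_op H \<theta> h t s \<zeta> w x)"
proof
  fix x
  have "(w (x - h) - w (x + h)) / (2 * h) = - ((w (x + h) - w (x - h)) / (2 * h))"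
    by (metis minus_diff_eq minus_divide_left)
  then show "S_op (\<lambda>p. - H (- p)) \<theta> h t s \<zeta> (\<lambda>x. - w x) x = - S_op H \<theta> h t s \<zeta> w x"
    by (simp add: S_op_def algebra_simps)
qed

lemma u_grid_uminus:
  "u_grid (\<lambda>p. - H (- p)) \<theta> W T (\<lambda>x. - u0 x) h \<rho> n = (\<lambda>x. - u_grid H \<theta> W T u0 h \<rho> n x)"
  by (induction n) (simp_all add: S_op_uminus)

lemma u_approx_uminus:
  "u_approx (\<lambda>p. - H (- p)) \<theta> W T (\<lambda>x. - u0 x) h \<rho> x t = - u_approx H \<theta> W T u0 h \<rho> x t"
  by (simp add: u_approx_def u_grid_uminus S_op_uminus Let_def)


section \<open>The error estimate\<close>

context regularized_kernel
begin

lemma subsolution_comparison: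
  assumes sub: "pathwise_subsolution H W T u0 u"
    and cont: "continuous_on (UNIV \<times> {0..T}) (\<lambda>(x, t). u x t)"
    and bdd: "\<And>x t. t \<in> {0..T} \<Longrightarrow> u x t \<le> U"
    and W: "continuous_on {0..T} W"
    and ab: "0 \<le> a" "a < b" "b \<le> T"
    and range: "\<And>t. t \<in> {a..b} \<Longrightarrow> \<bar>W t - c\<bar> + \<eta> \<le> r" and \<eta>: "0 < \<eta>"
    and init: "\<And>x. u x a - kernel (x - y) (W a - c) \<le> m"
  shows "u x b - kernel (x - y) (W b - c) \<le> m"
proof (rule ccontr)
  define Q where "Q x t = u x t - kernel (x - y) (W t - c)" for x t
  assume "\<not> ?thesis"
  then have Qb: "m < Q x b" by (simp add: Q_def)
  have sub_T: "{a..b} \<subseteq> {0..T}" using ab by auto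
  have W_ab: "continuous_on {a..b} W" using W sub_T continuous_on_subset by blast
  have Q_cont: "continuous_on (UNIV \<times> {a..b}) (\<lambda>z. Q (fst z) (snd z))"
  proof -
    have "continuous_on (UNIV \<times> {a..b}) (\<lambda>z. u (fst z) (snd z))"
      using continuous_on_subset[OF cont, of "UNIV \<times> {a..b}"] sub_T
      by (simp add: case_prod_unfold Sigma_mono)
    moreover have "continuous_on (UNIV \<times> {a..b}) (\<lambda>z::real \<times> real. W (snd z))"
      by (rule continuous_on_compose2[OF W_ab]) (auto intro!: continuous_intros)
    ultimately show ?thesis unfolding Q_def
      by (intro continuous_on_diff continuous_on_kernel continuous_intros)
  qed
  have "continuous_on {a..b} (\<lambda>t. Q (fst (x, t)) (snd (x, t)))"
    by (rule continuous_on_compose2[OF Q_cont]) (auto intro!: continuous_intros)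
  then have Qx_cont: "continuous_on {a..b} (Q x)" by simp
  define \<epsilon> where "\<epsilon> = (Q x b - m) / 2"
  have \<epsilon>: "0 < \<epsilon>" using Qb by (simp add: \<epsilon>_def)
  obtain d where d: "0 < d" "\<And>t. t \<in> {a..b} \<Longrightarrow> dist t b < d \<Longrightarrow> dist (Q x t) (Q x b) < \<epsilon>"
    using Qx_cont \<epsilon> ab(2) unfolding continuous_on_iff by (metis atLeastAtMost_iff less_imp_le order_refl)
  \<comment> \<open>By continuity more than half of the excess at \<open>b\<close> is still present
    at this earlier time, which leaves room for a penalty near \<open>b\<close>.\<close>
  define t1 where "t1 = max ((a + b) / 2) (b - d / 2)"
  have t1: "a < t1" "t1 < b" "dist t1 b < d"
    using ab(2) d(1) by (auto simp: t1_def dist_real_def max_def field_simps)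
  have Q_t1: "m + \<epsilon> < Q x t1"
    using d(2)[of t1] t1 by (auto simp: dist_real_def \<epsilon>_def abs_if field_simps split: if_splits)
  obtain A where A: "0 \<le> A" "\<And>p. \<bar>p\<bar> \<le> L \<Longrightarrow> \<bar>H p\<bar> \<le> A" using H_bounded_on by blast
  define Qmax where "Qmax = U + \<delta> * L\<^sup>2 / 2 + A * r"
  have Q_le: "Q x t \<le> Qmax - L * \<bar>x - y\<bar>" if "t \<in> {a..b}" for x t
  proof -
    have "A * \<bar>W t - c\<bar> \<le> A * r" using range[OF that] \<eta> A(1) by (intro mult_left_mono) auto
    then show ?thesis
      using kernel_coercive[OF A(2), of "x - y" "W t - c"] bdd[of t x] that sub_T
      by (auto simp: Q_def Qmax_def)
  qed
  \<comment> \<open>Since \<open>Qmax\<close> bounds the difference on the whole strip, a penalty of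
    size \<open>N\<close> at \<open>b\<close> brings it below \<open>m\<close> there.\<close>
  define N where "N = \<bar>Qmax - m\<bar> + 1"
  have N: "0 < N" by (simp add: N_def)
  define q where "q t = (t - a) / (b - a)" for t
  have q_t1: "q t1 < 1" and q_a: "q a = 0" and q_b: "q b = 1"
    using ab t1 by (auto simp: q_def)
  obtain k' where k': "(q t1) ^ k' < \<epsilon> / (2 * N)"
    using real_arch_pow_inv[of "\<epsilon> / (2 * N)" "q t1"] q_t1 \<epsilon> N by auto
  \<comment> \<open>A positive exponent is needed so that the power, and with it \<psi>, vanishes at
    \<open>a\<close>.\<close>
  define k where "k = Suc k'"
  have q_t1_pos: "0 < q t1" using t1 ab by (simp add: q_def)
  have "(q t1) ^ k \<le> (q t1) ^ k'" unfolding k_def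
    using q_t1 q_t1_pos by (intro power_decreasing) auto
  then have "N * (q t1) ^ k \<le> N * (q t1) ^ k'" using N by (intro mult_left_mono) auto
  moreover have "N * (q t1) ^ k' < \<epsilon> / 2" using k' N by (simp add: field_simps)
  ultimately have k: "N * (q t1) ^ k < \<epsilon> / 2" by linarith
  \<comment> \<open>The power, negligible at \<open>t1\<close> and large at \<open>b\<close>, keeps the maximum away from the end point \<open>b\<close>,
    where the definition of subsolution gives no information.\<close>
  define \<gamma> where "\<gamma> = \<epsilon> / 2 / (b - a)"
  have \<gamma>: "0 < \<gamma>" using \<epsilon> ab by (simp add: \<gamma>_def)
  define \<psi> where "\<psi> t = \<gamma> * (t - a) + N * (q t) ^ k" for t
  define \<psi>' where "\<psi>' t = \<gamma> + N * (real k * (q t) ^ (k - 1) * (1 / (b - a)))" for t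
  have q_deriv: "(q has_real_derivative 1 / (b - a)) (at t within X)" for t X
    unfolding q_def using ab by (auto intro!: derivative_eq_intros)
  have "(\<psi> has_real_derivative \<psi>' t) (at t within X)" for t X
    unfolding \<psi>_def \<psi>'_def by (auto intro!: derivative_eq_intros q_deriv)
  moreover have "continuous_on X \<psi>'" for X
    unfolding \<psi>'_def q_def using ab by (intro continuous_intros) auto
  ultimately have C1: "C1_closed T \<psi> \<psi>'" by (simp add: C1_closed_def)
  define P where "P x t = Q x t - \<psi> t" for x t
  \<comment> \<open>At \<open>t1\<close> the linear part of \<psi> costs at most half of \<epsilon>
    and the power less than half, so the value there still exceeds \<open>m\<close>.\<close>
  have "\<gamma> * (t1 - a) \<le> \<gamma> * (b - a)" using \<gamma> t1 by (intro mult_left_mono) auto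
  moreover have "\<gamma> * (b - a) = \<epsilon> / 2"
    using ab by (intro nonzero_eq_divide_eq[THEN iffD1]) (auto simp: \<gamma>_def)
  ultimately have "\<gamma> * (t1 - a) \<le> \<epsilon> / 2" by simp
  then have P_t1: "m < P x t1" using Q_t1 k by (simp add: P_def \<psi>_def)
  have \<psi>_nonneg: "0 \<le> \<psi> t" if "t \<in> {a..b}" for t
    using that \<gamma> N ab by (auto simp: \<psi>_def q_def intro!: add_nonneg_nonneg mult_nonneg_nonneg)
  \<comment> \<open>Beyond this radius coercivity keeps the difference at most \<open>m\<close>, so
    a maximum over the box is global in the strip. The first entry of \<open>max\<close> puts
    \<open>x\<close> into the box.\<close>
  define R where "R = max \<bar>x - y\<bar> (\<bar>Qmax - m\<bar> / L)"
  have R: "\<bar>x - y\<bar> \<le> R" "\<bar>Qmax - m\<bar> \<le> L * R"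
    using L_pos by (auto simp: R_def field_simps max_def)
  have P_cont: "continuous_on ({y - R..y + R} \<times> {a..b}) (\<lambda>z. P (fst z) (snd z))"
  proof -
    have "continuous_on ({y - R..y + R} \<times> {a..b}) (\<lambda>z. Q (fst z) (snd z))"
      by (rule continuous_on_subset[OF Q_cont]) auto
    then show ?thesis unfolding P_def \<psi>_def q_def using ab by (intro continuous_intros) auto
  qed
  have mem: "(x', t') \<in> {y - R..y + R} \<times> {a..b}" if "\<bar>x' - y\<bar> \<le> R" "t' \<in> {a..b}" for x' t'
    using that by (auto simp: abs_le_iff)
  have "(x, t1) \<in> {y - R..y + R} \<times> {a..b}" using R(1) t1 by (intro mem) auto
  then obtain z where z: "z \<in> {y - R..y + R} \<times> {a..b}"
    "\<And>z'. z' \<in> {y - R..y + R} \<times> {a..b} \<Longrightarrow> P (fst z') (snd z') \<le> P (fst z) (snd z)"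
    using continuous_attains_sup[OF _ _ P_cont] compact_Times[OF compact_Icc compact_Icc] by blast
  define x0 t0 where "x0 = fst z" and "t0 = snd z"
  have t0: "t0 \<in> {a..b}" using z(1) by (auto simp: t0_def)
  have P_big: "m < P x0 t0"
    using P_t1 z(2)[OF mem[of x t1]] R(1) t1 by (auto simp: x0_def t0_def)
  have global: "P x' t' \<le> P x0 t0" if "t' \<in> {a..b}" for x' t'
  proof (cases "\<bar>x' - y\<bar> \<le> R")
    case True
    then show ?thesis using z(2)[OF mem[OF _ that, of x']] that by (auto simp: x0_def t0_def)
  next
    case False
    then have "L * R \<le> L * \<bar>x' - y\<bar>" using L_pos by (intro mult_left_mono) auto
    then have "P x' t' \<le> m"
      using Q_le[OF that, of x'] \<psi>_nonneg[OF that] R(2) by (simp add: P_def)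
    then show ?thesis using P_big by simp
  qed
  have "t0 \<noteq> a"
  proof
    assume "t0 = a"
    moreover have "P x0 a \<le> m" using init[of x0] q_a by (simp add: P_def Q_def \<psi>_def k_def)
    ultimately show False using P_big by simp
  qed
  moreover have "t0 \<noteq> b"
  proof
    assume "t0 = b"
    moreover have "P x0 b \<le> m"
    proof -
      have "0 \<le> \<gamma> * (b - a)" "0 \<le> L * \<bar>x0 - y\<bar>" using \<gamma> ab L_pos by auto
      then show ?thesis
        using Q_le[of b x0] ab q_b by (simp add: P_def \<psi>_def N_def)
    qed
    ultimately show False using P_big by simp
  qed
  ultimately have t0': "t0 \<in> {a<..<b}" using t0 by auto
  have kernel_sol: "C11_solution H W {a<..<b} (\<lambda>x t. kernel (x - y) (W t - c))"
    by (rule C11_solution_kernel[OF W_ab range \<eta>])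
  have "local_max_at (UNIV \<times> {a<..<b}) (\<lambda>(x, t). u x t - kernel (x - y) (W t - c) - \<psi> t) (x0, t0)"
    unfolding local_max_at_def
  proof
    show "\<forall>\<^sub>F z in at (x0, t0) within UNIV \<times> {a<..<b}.
        (case z of (x, t) \<Rightarrow> u x t - kernel (x - y) (W t - c) - \<psi> t)
        \<le> (case (x0, t0) of (x, t) \<Rightarrow> u x t - kernel (x - y) (W t - c) - \<psi> t)"
      unfolding eventually_at_filter
      using global by (intro always_eventually) (auto simp: P_def Q_def)
  qed (use t0' in simp)
  then have "\<psi>' t0 \<le> 0"
    using sub C1 kernel_sol ab unfolding pathwise_subsolution_def by blast
  moreover have "0 < \<psi>' t0"
    using \<gamma> N ab t0 by (auto simp: \<psi>'_def q_def intro!: add_pos_nonneg)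
  ultimately show False by simp
qed

text \<open>One step of the scheme in \<open>y\<close>, with \<open>x\<close> and \<open>v\<close>
  frozen. The second difference of the kernel costs \<open>\<theta> * h\<^sup>2 / \<mu>\<close>, and
  replacing its slope by the central difference in the flux costs
  \<open>\<theta> * h\<^sup>2 / (2 * \<mu>)\<close>.\<close>

lemma kernel_S_op:
  assumes \<xi>: "\<bar>\<xi>\<bar> \<le> r" and h: "0 < h" and \<theta>: "0 \<le> \<theta>"
    and cfl: "B * \<bar>\<zeta> t - \<zeta> s\<bar> \<le> \<theta> * h"
  shows "v - kernel (x - y) (\<xi> - (\<zeta> t - \<zeta> s))
    \<le> S_op H \<theta> h t s \<zeta> (\<lambda>y. v - kernel (x - y) \<xi>) y + 3 * \<theta> * h\<^sup>2 / (2 * \<mu>)"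
proof -
  define z \<Delta> where "z = x - y" and "\<Delta> = \<zeta> t - \<zeta> s"
  define p pp pm where "p = slope z \<xi>" and "pp = slope (z + h) \<xi>" and "pm = slope (z - h) \<xi>"
  define k kp km where "k = kernel z \<xi>" and "kp = kernel (z + h) \<xi>" and "km = kernel (z - h) \<xi>"
  have slopes: "\<bar>pp - p\<bar> \<le> h / \<mu>" "\<bar>pm - p\<bar> \<le> h / \<mu>"
    using slope_lipschitz[OF \<xi>, of "z + h" \<xi> z] slope_lipschitz[OF \<xi>, of "z - h" \<xi> z] h
    by (auto simp: p_def pp_def pm_def)
  have tangents: "k + p * h \<le> kp" "kp - pp * h \<le> k" "k - p * h \<le> km" "km + pm * h \<le> k"
    using kernel_tangent[of z \<xi> "z + h" \<xi>] kernel_tangent[of "z + h" \<xi> z \<xi>]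
      kernel_tangent[of z \<xi> "z - h" \<xi>] kernel_tangent[of "z - h" \<xi> z \<xi>]
    by (simp_all add: p_def pp_def pm_def k_def kp_def km_def)
  have ph: "(pp - p) * h \<le> h / \<mu> * h" "(p - pm) * h \<le> h / \<mu> * h"
    using slopes h mult_right_mono[of "pp - p" "h / \<mu>" h] mult_right_mono[of "p - pm" "h / \<mu>" h]
    by auto
  have second: "kp + km - 2 * k \<le> 2 * h\<^sup>2 / \<mu>"
  proof -
    have "kp + km - 2 * k \<le> (pp - p) * h + (p - pm) * h" using tangents by (simp add: algebra_simps)
    also have "\<dots> \<le> 2 * (h / \<mu> * h)" using ph by simp
    finally show ?thesis by (simp add: power2_eq_square)
  qed
  define D where "D = (kp - km) / (2 * h)"
  have "\<bar>kp - km - 2 * h * p\<bar> \<le> h / \<mu> * h"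
    using tangents ph by (auto simp: abs_le_iff algebra_simps)
  moreover have "kp - km = 2 * h * D" using h by (simp add: D_def)
  ultimately have "\<bar>2 * h * (D - p)\<bar> \<le> h / \<mu> * h" by (simp add: algebra_simps)
  then have "2 * h * \<bar>D - p\<bar> \<le> h / \<mu> * h" using h by (simp only: abs_mult abs_numeral abs_of_pos)
  then have "h * (2 * \<bar>D - p\<bar>) \<le> h * (h / \<mu>)" by (simp only: mult_ac)
  then have central: "2 * \<bar>D - p\<bar> \<le> h / \<mu>" using h mult_left_le_imp_le by blast
  have "(H p - H D) * \<Delta> \<le> \<bar>H p - H D\<bar> * \<bar>\<Delta>\<bar>" by (simp flip: abs_mult)
  also have "\<dots> \<le> B * \<bar>p - D\<bar> * \<bar>\<Delta>\<bar>" by (intro mult_right_mono H_lipschitz) auto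
  also have "\<dots> = (B * \<bar>\<Delta>\<bar>) * \<bar>p - D\<bar>" by (simp add: mult_ac)
  also have "\<dots> \<le> (\<theta> * h) * (h / \<mu> / 2)"
  proof (rule mult_mono[OF cfl[folded \<Delta>_def]])
    show "\<bar>p - D\<bar> \<le> h / \<mu> / 2" using central by (simp add: abs_minus_commute)
  qed (use \<theta> h in auto)
  finally have flux: "(H p - H D) * \<Delta> \<le> \<theta> * h\<^sup>2 / (2 * \<mu>)" by (simp add: power2_eq_square)
  \<comment> \<open>Convexity in \<xi> gives the favourable sign, so no error quadratic in \<Delta>
    arises.\<close>
  have "k - H p * \<Delta> \<le> kernel z (\<xi> - \<Delta>)"
    using kernel_tangent[of z \<xi> z "\<xi> - \<Delta>"] by (simp add: p_def k_def)
  moreover have "S_op H \<theta> h t s \<zeta> (\<lambda>y. v - kernel (x - y) \<xi>) y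
      = v - k + H D * \<Delta> - \<theta> / 2 * (kp + km - 2 * k)"
  proof -
    have "x - (y + h) = z - h" "x - (y - h) = z + h" "x - y = z" by (auto simp: z_def)
    then show ?thesis
      by (simp add: S_op_def k_def kp_def km_def D_def \<Delta>_def algebra_simps)
  qed
  moreover have "\<theta> / 2 * (kp + km - 2 * k) \<le> \<theta> / 2 * (2 * h\<^sup>2 / \<mu>)"
    using second \<theta> by (intro mult_left_mono) auto
  moreover have "3 * \<theta> * h\<^sup>2 / (2 * \<mu>) = \<theta> * h\<^sup>2 / (2 * \<mu>) + \<theta> / 2 * (2 * h\<^sup>2 / \<mu>)"
    using \<mu>_pos by (simp add: field_simps)
  ultimately show ?thesis
    unfolding z_def[symmetric] \<Delta>_def[symmetric] using flux[unfolded left_diff_distrib] by linarith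
qed

text \<open>The three terms are the regularization error at time 0, the consistency error
  \<open>E\<close> of each step taken, and the value of the kernel on the diagonal
  \<open>x = y\<close>.\<close>

lemma one_sided_scheme_error:
  assumes sub: "pathwise_subsolution H W T u0 u"
    and cont: "continuous_on (UNIV \<times> {0..T}) (\<lambda>(x, t). u x t)"
    and bdd: "\<And>x t. t \<in> {0..T} \<Longrightarrow> u x t \<le> U"
    and u0: "\<And>x y. \<bar>u0 x - u0 y\<bar> \<le> L * \<bar>x - y\<bar>"
    and W: "continuous_on {0..T} W" and mod: "modulus_of_continuity \<omega> W T"
    and T: "0 < T" and h: "0 < h" and \<rho>: "0 < \<rho>" and M: "1 \<le> M_steps \<rho>"
    and \<theta>: "0 \<le> \<theta>" "\<theta> \<le> 1"
    and cfl: "B * (\<omega> (sqrt \<rho>) / real (M_steps \<rho>)) \<le> \<theta> * h"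
    and r: "r = 3 * \<omega> (sqrt \<rho>)" and \<omega>: "0 < \<omega> (sqrt \<rho>)"
    and A: "\<And>p. \<bar>p\<bar> \<le> L \<Longrightarrow> \<bar>H p\<bar> \<le> A"
    and t: "t \<in> {0..T}"
  shows "u x t - u_approx H \<theta> W T u0 h \<rho> x t
    \<le> \<delta> * L\<^sup>2 / 2 + (t / \<rho> + 1) * (3 * \<theta> * h\<^sup>2 / (2 * \<mu>)) + A * \<omega> (sqrt \<rho>)"
proof -
  define w E V where "w = \<omega> (sqrt \<rho>)" and "E = 3 * \<theta> * h\<^sup>2 / (2 * \<mu>)" and "V = W_interp W T \<rho>"
  have w: "0 < w" "r = 3 * w" using \<omega> r by (auto simp: w_def)
  have E: "0 \<le> E" using \<theta> \<mu>_pos by (simp add: E_def)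
  have A0: "0 \<le> A" using A[of 0] L_pos by simp
  have \<delta>0: "0 \<le> \<delta>"
    using nondegenerate \<mu>_pos K_nonneg mult_nonneg_nonneg[of r K] w by linarith
  have M_w: "w / real (M_steps \<rho>) \<le> w" using w M by (simp add: divide_le_eq)
  have WV: "\<bar>W t - V t\<bar> \<le> w" if "t \<in> {0..T}" for t
    using W_interp_error[OF mod T \<rho> M] that by (simp add: w_def V_def)
  have VV: "\<bar>V t - V (real n * \<rho>)\<bar> \<le> w / real (M_steps \<rho>)"
    if "real n * \<rho> \<le> t" "t \<le> (real n + 1) * \<rho>" for n t
    using W_interp_increment[OF mod T \<rho> M that] by (simp add: w_def V_def)
  \<comment> \<open>With \<open>t\<close> free in the step, this serves both the induction over the
    grid and the last, possibly partial, step.\<close>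
  have step: "u x t - kernel (x - y) (W t - V t) \<le> S_op H \<theta> h t (real n * \<rho>) V v y + (m + E)"
    if inv: "\<And>x y. u x (real n * \<rho>) - kernel (x - y) (W (real n * \<rho>) - V (real n * \<rho>)) \<le> v y + m"
      and t: "real n * \<rho> < t" "t \<le> (real n + 1) * \<rho>" "t \<le> T" for n t v m x y
  proof -
    define c where "c = V (real n * \<rho>)"
    \<comment> \<open>The factor 3 in \<open>r\<close>: one \<open>w\<close> for the distance of the
      paths, one for the motion of the interpolation within a step, one for the margin.\<close>
    have range: "\<bar>W s - c\<bar> + w \<le> r" if s: "s \<in> {real n * \<rho>..t}" for s
    proof -
      have n0: "0 \<le> real n * \<rho>" using \<rho> by simp
      have "s \<in> {0..T}" "real n * \<rho> \<le> s" "s \<le> (real n + 1) * \<rho>" using s t n0 by auto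
      then show ?thesis using WV[of s] VV[of n s] M_w w by (auto simp: c_def)
    qed
    \<comment> \<open>\<open>W\<close> moves while the interpolated path stays at \<open>c\<close>.
      All \<open>y'\<close> are needed, since the scheme then acts in this variable.\<close>
    have "u x t - kernel (x - y') (W t - c) \<le> v y' + m" for y'
      by (rule subsolution_comparison[OF sub cont bdd W _ t(1) t(3) range w(1)])
        (use \<rho> inv in \<open>auto simp: c_def\<close>)
    have cfl': "B * \<bar>V t - V (real n * \<rho>)\<bar> \<le> \<theta> * h"
      using VV[of n t] t B_nonneg cfl
      by (auto simp: w_def intro: order_trans[OF mult_left_mono])
    have "u x t - kernel (x - y) (W t - c - (V t - V (real n * \<rho>)))
        \<le> S_op H \<theta> h t (real n * \<rho>) V (\<lambda>y. u x t - kernel (x - y) (W t - c)) y + E"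
      unfolding E_def using range[of t] t w by (intro kernel_S_op h \<theta> cfl') auto
    also have "S_op H \<theta> h t (real n * \<rho>) V (\<lambda>y. u x t - kernel (x - y) (W t - c)) y
        \<le> S_op H \<theta> h t (real n * \<rho>) V v y + m"
      by (rule S_op_mono[where \<zeta> = V and t = t and s = "real n * \<rho>", OF H_lipschitz cfl' h \<theta>(2)]) fact
    finally show ?thesis by (simp add: c_def)
  qed
  have inv: "u x (real n * \<rho>) - kernel (x - y) (W (real n * \<rho>) - V (real n * \<rho>))
      \<le> u_grid H \<theta> W T u0 h \<rho> n y + (\<delta> * L\<^sup>2 / 2 + real n * E)"
    if "real n * \<rho> \<le> T" for n x y
    using that
  proof (induction n arbitrary: x y)
    case 0
    \<comment> \<open>The kernel starts at \<xi> = 0, where its growth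
      \<open>L * \<bar>x - y\<bar>\<close> compensates the Lipschitz bound of
      \<open>u0\<close>.\<close>
    have "V 0 = W 0" using T by (simp add: V_def W_interp_def Let_def)
    then show ?case
      using sub kernel_coercive[OF A, of "x - y" 0] abs_le_D1[OF u0[of x y]]
      unfolding pathwise_subsolution_def by (simp add: algebra_simps) (smt (verit))
  next
    case (Suc n)
    have lt: "real n * \<rho> < real (Suc n) * \<rho>" using \<rho> by simp
    have "grid \<rho> T n = real n * \<rho>" "grid \<rho> T (Suc n) = real (Suc n) * \<rho>"
      using Suc.prems lt by (auto simp: grid_def)
    moreover have "u x (real (Suc n) * \<rho>) - kernel (x - y) (W (real (Suc n) * \<rho>) - V (real (Suc n) * \<rho>))
      \<le> S_op H \<theta> h (real (Suc n) * \<rho>) (real n * \<rho>) V (u_grid H \<theta> W T u0 h \<rho> n) y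
        + (\<delta> * L\<^sup>2 / 2 + real n * E + E)"
      by (rule step) (use Suc lt in \<open>auto simp: algebra_simps\<close>)
    ultimately show ?case by (simp add: V_def algebra_simps)
  qed
  have diag: "kernel (x - x) (W t - V t) \<le> A * w"
  proof -
    have "H (slope 0 (W t - V t)) * (W t - V t) \<le> \<bar>H (slope 0 (W t - V t))\<bar> * \<bar>W t - V t\<bar>"
      by (simp flip: abs_mult)
    also have "\<dots> \<le> A * w"
      using A0 A slope_bound WV[OF t] by (intro mult_mono) auto
    finally have "H (slope 0 (W t - V t)) * (W t - V t) \<le> A * w" .
    moreover have "0 \<le> \<delta> * (slope 0 (W t - V t))\<^sup>2 / 2" using \<delta>0 by simp
    ultimately show ?thesis by (simp add: kernel_def objective_def mult.commute)
  qed
  show ?thesis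
  proof (cases "t = 0")
    case True
    have "u x 0 \<le> u0 x" using sub by (simp add: pathwise_subsolution_def)
    moreover have "0 \<le> \<delta> * L\<^sup>2 / 2" "0 \<le> A * w" using \<delta>0 A0 w by auto
    ultimately show ?thesis using True E by (simp add: u_approx_def E_def w_def)
  next
    case False
    then have t0: "0 < t" using t by simp
    \<comment> \<open>The index used by \<open>u_approx\<close>, that is, the step whose half-open
      interval contains \<open>t\<close>.\<close>
    define n where "n = nat (\<lceil>t / \<rho>\<rceil> - 1)"
    have "1 \<le> \<lceil>t / \<rho>\<rceil>" using t0 \<rho> by (simp add: one_le_ceiling)
    then have "real n = real_of_int \<lceil>t / \<rho>\<rceil> - 1" by (simp add: n_def)
    then have n: "real n < t / \<rho>" "t / \<rho> \<le> real n + 1" by linarith+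
    then have nt: "real n * \<rho> < t" "t \<le> (real n + 1) * \<rho>" using \<rho> by (simp_all add: field_simps)
    then have nT: "real n * \<rho> \<le> T" using t by simp
    then have "u_approx H \<theta> W T u0 h \<rho> x t = S_op H \<theta> h t (real n * \<rho>) V (u_grid H \<theta> W T u0 h \<rho> n) x"
      using t0 by (simp add: u_approx_def Let_def n_def grid_def V_def min_absorb1)
    moreover have "u x t - kernel (x - x) (W t - V t)
      \<le> S_op H \<theta> h t (real n * \<rho>) V (u_grid H \<theta> W T u0 h \<rho> n) x + (\<delta> * L\<^sup>2 / 2 + real n * E + E)"
      using t by (intro step inv nt nT) auto
    moreover have "real n * E \<le> t / \<rho> * E" using n E by (intro mult_right_mono) auto
    ultimately show ?thesis using diag by (simp add: E_def[symmetric] w_def[symmetric] distrib_right)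
  qed
qed

end

section \<open>Choice of the kernel parameters and of the constant\<close>

lemma smooth_deriv_lipschitz_on_Icc:
  assumes "smooth H"
  shows "\<exists>K\<ge>0. \<forall>p q. \<bar>p\<bar> \<le> L \<longrightarrow> \<bar>q\<bar> \<le> L \<longrightarrow> \<bar>deriv H p - deriv H q\<bar> \<le> K * \<bar>p - q\<bar>"
proof -
  have d: "(deriv ^^ k) H field_differentiable at x" for k x
    using assms by (simp add: smooth_def)
  have d1: "(deriv H has_real_derivative deriv (deriv H) x) (at x)" for x
    using d[of 1 x] by (simp add: DERIV_deriv_iff_field_differentiable)
  have "isCont (deriv (deriv H)) x" for x
    using d[of 2 x] by (simp add: numeral_2_eq_2 field_differentiable_imp_continuous_at)
  then have "compact (deriv (deriv H) ` {- L..L})"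
    by (intro compact_continuous_image continuous_at_imp_continuous_on) auto
  then obtain K where K: "0 < K" "\<And>x. x \<in> {- L..L} \<Longrightarrow> \<bar>deriv (deriv H) x\<bar> \<le> K"
    using compact_imp_bounded bounded_pos by (metis imageI real_norm_def)
  have "\<bar>deriv H p - deriv H q\<bar> \<le> K * \<bar>p - q\<bar>" if "\<bar>p\<bar> \<le> L" "\<bar>q\<bar> \<le> L" for p q
    using field_differentiable_bound[of "{- L..L}" "deriv H" "deriv (deriv H)" K p q]
      d1[THEN has_field_derivative_at_within] K(2) that by (auto simp: abs_le_iff)
  then show ?thesis using K(1) by (intro exI[of _ K]) auto
qed

theorem theorem1p3:
  fixes H :: "real \<Rightarrow> real" and \<theta> lam L :: real
  assumes "smooth H" and "bounded (range (deriv H))"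
    and "0 < \<theta>" and "\<theta> \<le> 1"
    and "0 < lam" and "lam * sup_norm (deriv H) < \<theta>"
    and "0 < L"
  shows "\<exists>C>0. \<forall>(T::real) (u0 :: real \<Rightarrow> real) (W :: real \<Rightarrow> real) (\<omega> :: real \<Rightarrow> real)
           (h::real) (\<rho>::real) (u :: real \<Rightarrow> real \<Rightarrow> real).
      0 < T \<longrightarrow>
      bounded (range u0) \<longrightarrow> lipschitz_with_deriv_bound L u0 \<longrightarrow>
      continuous_on {0..T} W \<longrightarrow> modulus_of_continuity \<omega> W T \<longrightarrow>
      0 < h \<longrightarrow> 0 < \<rho> \<longrightarrow> lam = sqrt \<rho> * \<omega> (sqrt \<rho>) / h \<longrightarrow>
      1 \<le> M_steps \<rho> \<longrightarrow> lam * sup_norm (deriv H) \<le> \<theta> * (sqrt \<rho> * real (M_steps \<rho>)) \<longrightarrow>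
      pathwise_solution H W T u0 u \<longrightarrow>
      (SUP (x, t) \<in> UNIV \<times> {0..T}. ereal \<bar>u_approx H \<theta> W T u0 h \<rho> x t - u x t\<bar>)
        \<le> ereal (C * (1 + T) * \<omega> (sqrt \<rho>))"
proof -
  define B where "B = sup_norm (deriv H)"
  have H_deriv: "(H has_real_derivative deriv H p) (at p)" for p
    using assms(1)[unfolded smooth_def, rule_format, of 0 p]
    by (simp add: DERIV_deriv_iff_field_differentiable)
  have B: "\<bar>deriv H p\<bar> \<le> B" for p
  proof -
    have "bdd_above (range (\<lambda>x. \<bar>deriv H x\<bar>))"
      using assms(2) by (auto simp: bounded_iff bdd_above_def)
    then show ?thesis unfolding B_def sup_norm_def by (intro cSUP_upper) auto
  qed
  obtain K where K: "0 \<le> K"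
    "\<And>p q. \<bar>p\<bar> \<le> L \<Longrightarrow> \<bar>q\<bar> \<le> L \<Longrightarrow> \<bar>deriv H p - deriv H q\<bar> \<le> K * \<bar>p - q\<bar>"
    using smooth_deriv_lipschitz_on_Icc[OF assms(1)] by blast
  define A where "A = \<bar>H 0\<bar> + B * L"
  have B0: "0 \<le> B" using B[of 0] by linarith
  have A: "\<bar>H p\<bar> \<le> A" if "\<bar>p\<bar> \<le> L" for p
  proof -
    have "\<bar>H p - H 0\<bar> \<le> B * \<bar>p - 0\<bar>"
      using field_differentiable_bound[of UNIV H "deriv H" B p 0] H_deriv B by simp
    then show ?thesis using mult_left_mono[OF that B0] by (simp add: A_def)
  qed
  have A0: "0 \<le> A" using A[of 0] assms(7) by simp
  \<comment> \<open>The three errors for \<open>\<delta> = (3 * K + 1) * w\<close> and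
    \<open>\<mu> = w\<close>, each divided by \<open>w\<close>. In the middle one
    \<open>h\<^sup>2 = \<rho> * w\<^sup>2 / lam\<^sup>2\<close>, whose factor \<rho> cancels the
    number of steps per unit time.\<close>
  define C where "C = (3 * K + 1) * L\<^sup>2 / 2 + 3 * \<theta> / (2 * lam\<^sup>2) + A"
  have "0 < (3 * K + 1) * L\<^sup>2 / 2" using K(1) assms(7) by (simp add: zero_less_mult_iff)
  then have C: "0 < C" unfolding C_def
    using A0 assms(3,5) by (intro add_pos_nonneg) auto
  have main: "\<bar>u_approx H \<theta> W T u0 h \<rho> x t - u x t\<bar> \<le> C * (1 + T) * \<omega> (sqrt \<rho>)"
    if T: "0 < T" and u0: "lipschitz_with_deriv_bound L u0"
      and W: "continuous_on {0..T} W" and mod: "modulus_of_continuity \<omega> W T"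
      and h: "0 < h" and \<rho>: "0 < \<rho>" and lam: "lam = sqrt \<rho> * \<omega> (sqrt \<rho>) / h"
      and M: "1 \<le> M_steps \<rho>" and cfl: "lam * B \<le> \<theta> * (sqrt \<rho> * real (M_steps \<rho>))"
      and u: "pathwise_solution H W T u0 u" and t: "t \<in> {0..T}"
    for T u0 W \<omega> h \<rho> u x t
  proof -
    define w where "w = \<omega> (sqrt \<rho>)"
    \<comment> \<open>If \<open>w\<close> were zero, then \<open>lam\<close> would be zero.\<close>
    have "0 \<le> w" "w \<noteq> 0"
      using mod lam assms(5) \<rho> by (auto simp: w_def modulus_of_continuity_def)
    then have w: "0 < w" by simp
    have lam_h: "lam * h = sqrt \<rho> * w" using lam h by (simp add: w_def)
    \<comment> \<open>At least one step per block forces \<rho> to be at most 1; this lets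
      \<open>t + \<rho>\<close> be bounded by \<open>1 + T\<close>.\<close>
    have \<rho>1: "\<rho> \<le> 1"
    proof -
      have "1 * sqrt \<rho> \<le> real (M_steps \<rho>) * sqrt \<rho>" using M \<rho> by (intro mult_right_mono) auto
      then have "sqrt \<rho> \<le> 1" using M_steps_sqrt_le[OF \<rho>] by linarith
      then show ?thesis by simp
    qed
    have cfl': "B * (w / real (M_steps \<rho>)) \<le> \<theta> * h"
    proof -
      have "sqrt \<rho> * (w * B) = lam * h * B" by (simp add: lam_h)
      also have "\<dots> = (lam * B) * h" by (simp add: mult_ac)
      also have "\<dots> \<le> \<theta> * (sqrt \<rho> * real (M_steps \<rho>)) * h"
        using cfl h by (intro mult_right_mono) auto
      also have "\<dots> = sqrt \<rho> * (\<theta> * h * real (M_steps \<rho>))" by (simp add: mult_ac)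
      finally have "w * B \<le> \<theta> * h * real (M_steps \<rho>)" using \<rho> by simp
      then show ?thesis using M by (simp add: field_simps)
    qed
    have h_sq: "h\<^sup>2 = \<rho> * w\<^sup>2 / lam\<^sup>2"
    proof -
      have "(lam * h)\<^sup>2 = \<rho> * w\<^sup>2" unfolding lam_h using \<rho> by (simp add: power_mult_distrib)
      then show ?thesis using assms(5) by (simp add: power_mult_distrib field_simps)
    qed
    have bound: "(3 * K + 1) * w * L\<^sup>2 / 2 + (t / \<rho> + 1) * (3 * \<theta> * h\<^sup>2 / (2 * w)) + A * \<omega> (sqrt \<rho>)
        \<le> C * (1 + T) * w"
    proof -
      have distrib: "(X + Y + Z) * (1 + T) * w = (1 + T) * (X * w) + (1 + T) * (Y * w) + (1 + T) * (Z * w)"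
        for X Y Z :: real by (simp add: algebra_simps)
      have "(t / \<rho> + 1) * (3 * \<theta> * h\<^sup>2 / (2 * w)) = (t + \<rho>) * (3 * \<theta> / (2 * lam\<^sup>2) * w)"
        unfolding h_sq using \<rho> w assms(5) by (simp add: field_simps power2_eq_square)
      also have "\<dots> \<le> (1 + T) * (3 * \<theta> / (2 * lam\<^sup>2) * w)"
        using t \<rho>1 w assms(3) by (intro mult_right_mono) auto
      finally have "(t / \<rho> + 1) * (3 * \<theta> * h\<^sup>2 / (2 * w)) \<le> (1 + T) * (3 * \<theta> / (2 * lam\<^sup>2) * w)" .
      moreover have "1 * ((3 * K + 1) * L\<^sup>2 / 2 * w) \<le> (1 + T) * ((3 * K + 1) * L\<^sup>2 / 2 * w)"
        "1 * (A * w) \<le> (1 + T) * (A * w)"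
        using T w K(1) A0 by (intro mult_right_mono; simp)+
      moreover have "(3 * K + 1) * w * L\<^sup>2 / 2 = 1 * ((3 * K + 1) * L\<^sup>2 / 2 * w)" by simp
      ultimately show ?thesis unfolding C_def distrib w_def[symmetric] by linarith
    qed
    have L_u0: "\<bar>u0 x - u0 y\<bar> \<le> L * \<bar>x - y\<bar>" for x y
      by (rule lipschitz_with_deriv_boundD[OF u0])
    have sub: "pathwise_subsolution H W T u0 u" and sup: "pathwise_supersolution H W T u0 u"
      and cont: "continuous_on (UNIV \<times> {0..T}) (\<lambda>(x, t). u x t)"
      using u by (auto simp: pathwise_solution_def uniformly_continuous_imp_continuous)
    obtain U where "\<forall>x. \<forall>t\<in>{0..T}. \<bar>u x t\<bar> \<le> U"
      using u unfolding pathwise_solution_def bounded_iff by auto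
    then have U: "\<bar>u x t\<bar> \<le> U" if "t \<in> {0..T}" for x t using that by blast
    have up: "u x t - u_approx H \<theta> W T u0 h \<rho> x t \<le> C * (1 + T) * w"
    proof -
      \<comment> \<open>With \<open>r = 3 * w\<close> and \<open>\<mu> = w\<close>, this \<delta>
        gives equality in \<open>nondegenerate\<close>.\<close>
      interpret regularized_kernel H "deriv H" L "(3 * K + 1) * w" "3 * w" w B K
        by unfold_locales (use H_deriv B K assms(7) w in \<open>auto simp: algebra_simps\<close>)
      show ?thesis
        by (rule order_trans[OF one_sided_scheme_error[OF sub cont _ L_u0 W mod T h \<rho> M _ _ _ _ _ A t]
              bound])
          (use U assms(3,4) w cfl' in \<open>auto simp: w_def abs_le_iff\<close>)
    qed
    have down: "- u x t - - u_approx H \<theta> W T u0 h \<rho> x t \<le> C * (1 + T) * w"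
    proof -
      interpret regularized_kernel "\<lambda>p. - H (- p)" "\<lambda>p. deriv H (- p)" L "(3 * K + 1) * w" "3 * w" w B K
      proof
        show "((\<lambda>p. - H (- p)) has_real_derivative deriv H (- p)) (at p)" for p
          using DERIV_minus[OF DERIV_mirror[THEN iffD1, OF H_deriv[of "- p"]]] by simp
        show "\<bar>deriv H (- p) - deriv H (- q)\<bar> \<le> K * \<bar>p - q\<bar>" if "\<bar>p\<bar> \<le> L" "\<bar>q\<bar> \<le> L" for p q
          using K(2)[of "- p" "- q"] that by (simp add: abs_minus_commute)
      qed (use B K assms(7) w in \<open>auto simp: algebra_simps\<close>)
      have cont': "continuous_on (UNIV \<times> {0..T}) (\<lambda>(x, t). - u x t)"
        using continuous_on_minus[OF cont] by (simp add: case_prod_unfold)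
      have L_u0': "\<bar>- u0 x - - u0 y\<bar> \<le> L * \<bar>x - y\<bar>" for x y
        using L_u0[of y x] by (simp add: abs_minus_commute)
      have A': "\<bar>- H (- p)\<bar> \<le> A" if "\<bar>p\<bar> \<le> L" for p using A[of "- p"] that by simp
      have U': "- u x t \<le> U" if "t \<in> {0..T}" for x t using U[OF that, of x] by (simp add: abs_le_iff)
      show ?thesis unfolding u_approx_uminus[symmetric]
        by (rule order_trans[OF one_sided_scheme_error[OF pathwise_subsolution_uminus[OF sup] cont' U'
                L_u0' W mod T h \<rho> M _ _ _ _ _ A' t] bound])
          (use assms(3,4) w cfl' in \<open>auto simp: w_def\<close>)
    qed
    show ?thesis using up down by (simp add: w_def abs_le_iff)
  qed
  show ?thesis
    using C main unfolding B_def
    by (intro exI[of _ C] conjI allI impI SUP_least) auto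
qed

end
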